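(* Let $\lambda\supseteq\mu$ be partitions with $\mathrm{rank}(\lambda/\mu)=r$. Then $$\mathrm{mbsd}(\lambda/\mu)=\mathrm{is}(\lambda/\mu)^2,\qquad \mathrm{mbst}(\lambda/\mu)=r!\,\mathrm{is}(\lambda/\mu),$$ where $\mathrm{mbsd}(\lambda/\mu)$ is the number of minimal border strip decompositions of $\lambda/\mu$ and $\mathrm{mbst}(\lambda/\mu)$ is the number of minimal border strip tableaux of shape $\lambda/\mu$.
   Context: Skew diagram $\lambda/\mu=\{(i,j):\mu_i<j\le\lambda_i\}$; square $(i,j)$ is drawn as $[j-1,j]\times[-i,-i+1]$. $\mathrm{rank}(\lambda/\mu)$: an outside top corner is $(i,j)\in\lambda/\mu$ with $(i-1,j),(i,j-1)\notin\lambda/\mu$; an inside top corner is $(i,j)\in\lambda/\mu$ with $(i-1,j),(i,j-1)\in\lambda/\mu$, $(i-1,j-1)\notin\lambda/\mu$; the diagonal of a corner $(i,j)$ is $\{(i+p,j+p)\in\lambda/\mu: p\ge0\}$; rank is the number of squares on outside diagonals minus the number on inside diagonals. A border strip is a nonempty edge-connected skew diagram with no $2\times2$ block. A border strip decomposition of $\lambda/\mu$ is a partition of its squares into border strips; minimal if it has the fewest strips. A border strip tableau of shape $\lambda/\mu$ is a chain of partitions $\mu=\lambda^0\subset\lambda^1\subset\cdots\subset\lambda^m=\lambda$ with each $\lambda^i/\lambda^{i-1}$ a border strip; its border strips form a border strip decomposition, and the tableau is minimal if this decomposition is minimal. Snakes and interval sets: for a partition $\alpha$, its boundary path goes up $x=0$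 from $y=-\infty$ to $(0,-\ell(\alpha))$, follows the lower-right boundary of the diagram of $\alpha$ to $(\alpha_1,0)$, then right along $y=0$; the step starting at $(x,y)$ has index $x+y$. For $k\in\mathbb{Z}$ let $e_k$ be step $k$ of the boundary path of $\lambda$. If $e_k$ is also a step of the path of $\mu$, $S_k=\emptyset$. Otherwise, if $e_k$ is horizontal it is the lower edge of $(i,j)\in\lambda/\mu$ and $S_k=(\lambda/\mu)\cap\{(i,j),(i,j-1),(i-1,j-1),(i-1,j-2),\dots\}$; if vertical it is the right edge of $(i,j)\in\lambda/\mu$ and $S_k=(\lambda/\mu)\cap\{(i,j),(i-1,j),(i-1,j-1),(i-2,j-1),\dots\}$. $\ell(S_k)=|S_k|-1$. $q_k=L$ ($S_k$ a left snake) if $e_k$ is horizontal and $\ell(S_k)\ge0$ is even; $q_k=R$ (right snake) if $e_k$ is vertical and $\ell(S_k)\ge0$ is even; otherwise $q_k=O$. An interval set is a set of $r$ pairs $(u_i,v_i)$ of integers, the $2r$ integers distinct, $u_i<v_i$, $q_{u_i}=L$, $q_{v_i}=R$. $\mathrm{is}(\lambda/\mu)$ is the number of interval sets. *)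

theory Defs
  imports Main "HOL-Library.Disjoint_Sets"
begin

section \<open>Partitions and skew diagrams\<close>

text \<open>A partition is the weakly decreasing list of its positive parts, so that every partition
  has exactly one representation. Squares are pairs of integers (row, column); row 1 is the
  topmost row and the parts beyond the length of the list are 0.\<close>

type_synonym square = "int \<times> int"

definition is_partition :: "nat list \<Rightarrow> bool" where
  "is_partition \<alpha> \<longleftrightarrow> sorted_wrt (\<ge>) \<alpha> \<and> 0 \<notin> set \<alpha>"

definition part :: "nat list \<Rightarrow> int \<Rightarrow> int" where
  "part \<alpha> i = (if 1 \<le> i \<and> i \<le> int (length \<alpha>) then int (\<alpha> ! nat (i - 1)) else 0)"

definition contained :: "nat list \<Rightarrow> nat list \<Rightarrow> bool" where
  "contained \<mu> lam \<longleftrightarrow> (\<forall>i\<ge>1. part \<mu> i \<le> part lam i)"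

definition skew :: "nat list \<Rightarrow> nat list \<Rightarrow> square set" where
  "skew lam \<mu> = {(i, j). 1 \<le> i \<and> part \<mu> i < j \<and> j \<le> part lam i}"

abbreviation diagram :: "nat list \<Rightarrow> square set" where
  "diagram \<alpha> \<equiv> skew \<alpha> []"

section \<open>Rank\<close>

definition outside_top_corners :: "square set \<Rightarrow> square set" where
  "outside_top_corners D = {(i, j) \<in> D. (i - 1, j) \<notin> D \<and> (i, j - 1) \<notin> D}"

definition inside_top_corners :: "square set \<Rightarrow> square set" where
  "inside_top_corners D =
     {(i, j) \<in> D. (i - 1, j) \<in> D \<and> (i, j - 1) \<in> D \<and> (i - 1, j - 1) \<notin> D}"

definition diagonal :: "square set \<Rightarrow> square \<Rightarrow> square set" where
  "diagonal D c = {(fst c + p, snd c + p) | p. 0 \<le> p} \<inter> D"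

definition skew_rank :: "nat list \<Rightarrow> nat list \<Rightarrow> int" where
  "skew_rank lam \<mu> = (let D = skew lam \<mu> in
     int (card (\<Union>c\<in>outside_top_corners D. diagonal D c)) -
     int (card (\<Union>c\<in>inside_top_corners D. diagonal D c)))"

section \<open>Border strip decompositions and tableaux\<close>

definition edge_adjacent :: "square \<Rightarrow> square \<Rightarrow> bool" where
  "edge_adjacent s t \<longleftrightarrow> \<bar>fst s - fst t\<bar> + \<bar>snd s - snd t\<bar> = 1"

definition edge_connected :: "square set \<Rightarrow> bool" where
  "edge_connected B \<longleftrightarrow>
     (\<forall>s\<in>B. \<forall>t\<in>B. (s, t) \<in> {(a, b). a \<in> B \<and> b \<in> B \<and> edge_adjacent a b}\<^sup>*)"

definition is_skew_diagram :: "square set \<Rightarrow> bool" where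
  "is_skew_diagram B \<longleftrightarrow>
     (\<exists>\<alpha> \<beta>. is_partition \<alpha> \<and> is_partition \<beta> \<and> contained \<beta> \<alpha> \<and> B = skew \<alpha> \<beta>)"

definition border_strip :: "square set \<Rightarrow> bool" where
  "border_strip B \<longleftrightarrow> is_skew_diagram B \<and> B \<noteq> {} \<and> edge_connected B \<and>
     (\<nexists>i j. {(i, j), (i, j + 1), (i + 1, j), (i + 1, j + 1)} \<subseteq> B)"

definition bs_decomposition :: "nat list \<Rightarrow> nat list \<Rightarrow> square set set \<Rightarrow> bool" where
  "bs_decomposition lam \<mu> P \<longleftrightarrow> partition_on (skew lam \<mu>) P \<and> (\<forall>B\<in>P. border_strip B)"

definition minimal_bsd :: "nat list \<Rightarrow> nat list \<Rightarrow> square set set \<Rightarrow> bool" where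
  "minimal_bsd lam \<mu> P \<longleftrightarrow>
     bs_decomposition lam \<mu> P \<and> (\<forall>Q. bs_decomposition lam \<mu> Q \<longrightarrow> card P \<le> card Q)"

definition mbsd :: "nat list \<Rightarrow> nat list \<Rightarrow> nat" where
  "mbsd lam \<mu> = card {P. minimal_bsd lam \<mu> P}"

text \<open>A tableau is the list of the partitions in its chain, from the inner to the outer one.\<close>

definition bs_tableau :: "nat list \<Rightarrow> nat list \<Rightarrow> nat list list \<Rightarrow> bool" where
  "bs_tableau lam \<mu> T \<longleftrightarrow>
     T \<noteq> [] \<and> hd T = \<mu> \<and> last T = lam \<and> (\<forall>\<alpha>\<in>set T. is_partition \<alpha>) \<and>
     (\<forall>i. Suc i < length T \<longrightarrow>
        contained (T ! i) (T ! Suc i) \<and> border_strip (skew (T ! Suc i) (T ! i)))"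

definition tableau_strips :: "nat list list \<Rightarrow> square set set" where
  "tableau_strips T = {skew (T ! Suc i) (T ! i) | i. Suc i < length T}"

definition minimal_bst :: "nat list \<Rightarrow> nat list \<Rightarrow> nat list list \<Rightarrow> bool" where
  "minimal_bst lam \<mu> T \<longleftrightarrow> bs_tableau lam \<mu> T \<and> minimal_bsd lam \<mu> (tableau_strips T)"

definition mbst :: "nat list \<Rightarrow> nat list \<Rightarrow> nat" where
  "mbst lam \<mu> = card {T. minimal_bst lam \<mu> T}"

section \<open>Snakes and interval sets\<close>

text \<open>The arguments of a step are the coordinates of its starting point in the plane in which
  square \<open>(i, j)\<close> is \<open>[j - 1, j] \<times> [- i, - i + 1]\<close>. Horizontal steps go right, vertical steps
  go up. So the lower edge of \<open>(i, j)\<close> is \<open>Horizontal (j - 1) (- i)\<close> and its right edge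
  is \<open>Vertical j (- i)\<close>.\<close>

datatype path_step = Horizontal int int | Vertical int int

fun step_index :: "path_step \<Rightarrow> int" where
  "step_index (Horizontal x y) = x + y"
| "step_index (Vertical x y) = x + y"

text \<open>The boundary path separates the diagram from the squares below and to the right of it.
  The steps with \<open>i = 0\<close> lie on the line \<open>y = 0\<close> (right of the first row), those with
  \<open>j = 0\<close> on the line \<open>x = 0\<close> (below the last row).\<close>

definition boundary_path :: "nat list \<Rightarrow> path_step set" where
  "boundary_path \<alpha> =
     {Horizontal (j - 1) (- i) | i j.
        0 \<le> i \<and> 1 \<le> j \<and> (i = 0 \<or> (i, j) \<in> diagram \<alpha>) \<and> (i + 1, j) \<notin> diagram \<alpha>} \<union>
     {Vertical j (- i) | i j.
        1 \<le> i \<and> 0 \<le> j \<and> (j = 0 \<or> (i, j) \<in> diagram \<alpha>) \<and> (i, j + 1) \<notin> diagram \<alpha>}"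

definition boundary_step :: "nat list \<Rightarrow> int \<Rightarrow> path_step" where
  "boundary_step \<alpha> k = (THE e. e \<in> boundary_path \<alpha> \<and> step_index e = k)"

lemma part_nonneg: "0 \<le> part \<alpha> i"
  by (simp add: part_def)

lemma part_antimono:
  assumes "is_partition \<alpha>" "1 \<le> i" "i \<le> i'"
  shows "part \<alpha> i' \<le> part \<alpha> i"
proof (cases "i' \<le> int (length \<alpha>) \<and> i < i'")
  case True
  then have "nat (i - 1) < nat (i' - 1)" "nat (i' - 1) < length \<alpha>"
    using assms by auto
  then have "\<alpha> ! nat (i' - 1) \<le> \<alpha> ! nat (i - 1)"
    using assms(1) sorted_wrt_nth_less[of "(\<ge>)" \<alpha>] unfolding is_partition_def by blast
  then show ?thesis using True assms by (simp add: part_def)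
next
  case False
  then show ?thesis using assms by (cases "i = i'") (auto simp: part_def)
qed

lemma mem_diagram: "(i, j) \<in> diagram \<alpha> \<longleftrightarrow> 1 \<le> i \<and> 1 \<le> j \<and> j \<le> part \<alpha> i"
  by (auto simp: skew_def part_def)

text \<open>The path has exactly one step of each index, so \<open>boundary_step\<close> is well defined.\<close>

lemma boundary_path_ex1:
  assumes \<alpha>: "is_partition \<alpha>"
  shows "\<exists>!e. e \<in> boundary_path \<alpha> \<and> step_index e = k"
proof -
  define g where "g i = part \<alpha> i - i" for i
  have g_mono: "g i' < g i" if "1 \<le> i" "i < i'" for i i'
    using part_antimono[OF \<alpha>, of i i'] that by (simp add: g_def)
  have H': "Horizontal x y \<in> boundary_path \<alpha> \<longleftrightarrow> 0 \<le> - y \<and> 1 \<le> x + 1 \<and>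
      (- y = 0 \<or> (- y, x + 1) \<in> diagram \<alpha>) \<and> (- y + 1, x + 1) \<notin> diagram \<alpha>" for x y
    unfolding boundary_path_def
    by (rule iffI, fastforce, rule UnI1, rule CollectI, rule exI[of _ "- y"],
        rule exI[of _ "x + 1"], simp)
  have V': "Vertical x y \<in> boundary_path \<alpha> \<longleftrightarrow> 1 \<le> - y \<and> 0 \<le> x \<and>
      (x = 0 \<or> (- y, x) \<in> diagram \<alpha>) \<and> (- y, x + 1) \<notin> diagram \<alpha>" for x y
    unfolding boundary_path_def
    by (rule iffI, fastforce, rule UnI2, rule CollectI, rule exI[of _ "- y"],
        rule exI[of _ x], simp)
  have H: "Horizontal x y \<in> boundary_path \<alpha> \<longleftrightarrow>
      y \<le> 0 \<and> (y = 0 \<or> g (- y) > x + y) \<and> g (1 - y) < x + y" for x y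
    using part_nonneg[of \<alpha> "- y + 1"] unfolding H' mem_diagram g_def
    by (auto simp: algebra_simps)
  have V: "Vertical x y \<in> boundary_path \<alpha> \<longleftrightarrow> y \<le> -1 \<and> g (- y) = x + y" for x y
    using part_nonneg[of \<alpha> "- y"] unfolding V' mem_diagram g_def by auto
  define P where "P n \<longleftrightarrow> g (int n + 1) \<le> k" for n
  have "P (nat (\<bar>k\<bar> + int (length \<alpha>)))"
    by (simp add: P_def g_def part_def) linarith
  then have P: "P (LEAST n. P n)" by (rule LeastI)
  define m where "m = int (LEAST n. P n)"
  have m0: "0 \<le> m" by (simp add: m_def)
  have m1: "g (m + 1) \<le> k" using P by (simp add: P_def m_def)
  have m2: "k < g i" if "1 \<le> i" "i \<le> m" for i
  proof -
    have "\<not> P (nat (i - 1))" using that by (intro not_less_Least) (simp add: m_def)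
    then show ?thesis using that by (simp add: P_def)
  qed
  have m_eq: "i = m" if "0 \<le> i" "g (i + 1) \<le> k" "i = 0 \<or> k < g i" for i
  proof (rule ccontr)
    assume "i \<noteq> m"
    then consider "i < m" | "m < i" by linarith
    then show False
    proof cases
      case 1 then show False using m2[of "i + 1"] that by simp
    next
      case 2
      then have "g i \<le> g (m + 1)" using g_mono[of "m + 1" i] m0 by (cases "i = m + 1") auto
      then show False using that m1 2 m0 by auto
    qed
  qed
  show ?thesis
  proof (cases "g (m + 1) = k")
    case True
    show ?thesis
    proof (rule ex1I[of _ "Vertical (k + m + 1) (- (m + 1))"])
      show "Vertical (k + m + 1) (- (m + 1)) \<in> boundary_path \<alpha> \<and>
          step_index (Vertical (k + m + 1) (- (m + 1))) = k"
        using True m0 by (simp add: V add.commute)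
      fix e assume e: "e \<in> boundary_path \<alpha> \<and> step_index e = k"
      show "e = Vertical (k + m + 1) (- (m + 1))"
      proof (cases e)
        case (Horizontal x y)
        then have "y \<le> 0" "y = 0 \<or> k < g (- y)" "g (1 - y) < k" using e H by auto
        moreover from this have "- y = m" by (intro m_eq) (auto simp: algebra_simps)
        ultimately show ?thesis using True by (auto simp: algebra_simps)
      next
        case (Vertical x y)
        then have y: "y \<le> -1" "g (- y) = k" "x + y = k" using e V by auto
        moreover have "- y - 1 = m"
          using y g_mono[of "- y - 1" "- y"] by (intro m_eq; cases "y = - 1"; auto)
        ultimately show ?thesis using Vertical by auto
      qed
    qed
  next
    case False
    show ?thesis
    proof (rule ex1I[of _ "Horizontal (k + m) (- m)"])
      show "Horizontal (k + m) (- m) \<in> boundary_path \<alpha> \<and>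
          step_index (Horizontal (k + m) (- m)) = k"
        using False m0 m1 m2[of m] by (cases "m = 0") (auto simp: H algebra_simps)
      fix e assume e: "e \<in> boundary_path \<alpha> \<and> step_index e = k"
      show "e = Horizontal (k + m) (- m)"
      proof (cases e)
        case (Horizontal x y)
        then have "y \<le> 0" "y = 0 \<or> k < g (- y)" "g (1 - y) < k" "x + y = k" using e H by auto
        moreover from this have "- y = m" by (intro m_eq) (auto simp: algebra_simps)
        ultimately show ?thesis using Horizontal by auto
      next
        case (Vertical x y)
        then have y: "y \<le> -1" "g (- y) = k" "x + y = k" using e V by auto
        moreover have "- y - 1 = m"
          using y g_mono[of "- y - 1" "- y"] by (intro m_eq; cases "y = - 1"; auto)
        ultimately show ?thesis using False by auto
      qed
    qed
  qed
qed

definition snake :: "nat list \<Rightarrow> nat list \<Rightarrow> int \<Rightarrow> square set" where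
  "snake lam \<mu> k = (let e = boundary_step lam k in
     if e \<in> boundary_path \<mu> then {}
     else skew lam \<mu> \<inter>
       (case e of
          Horizontal x y \<Rightarrow> (let i = - y; j = x + 1 in
            {(i - p, j - p) | p. 0 \<le> p} \<union> {(i - p, j - p - 1) | p. 0 \<le> p})
        | Vertical x y \<Rightarrow> (let i = - y; j = x in
            {(i - p, j - p) | p. 0 \<le> p} \<union> {(i - p - 1, j - p) | p. 0 \<le> p})))"

definition snake_length :: "nat list \<Rightarrow> nat list \<Rightarrow> int \<Rightarrow> int" where
  "snake_length lam \<mu> k = int (card (snake lam \<mu> k)) - 1"

datatype snake_type = Left_Snake | Right_Snake | No_Snake

definition snake_label :: "nat list \<Rightarrow> nat list \<Rightarrow> int \<Rightarrow> snake_type" where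
  "snake_label lam \<mu> k =
     (if snake_length lam \<mu> k \<ge> 0 \<and> even (snake_length lam \<mu> k)
      then (case boundary_step lam k of
              Horizontal x y \<Rightarrow> Left_Snake
            | Vertical x y \<Rightarrow> Right_Snake)
      else No_Snake)"

text \<open>The two entries of a single pair are distinct because of \<open>u < v\<close>; disjointness of the
  sets \<open>{u, v}\<close> makes the entries of different pairs distinct.\<close>

definition interval_set :: "nat list \<Rightarrow> nat list \<Rightarrow> (int \<times> int) set \<Rightarrow> bool" where
  "interval_set lam \<mu> I \<longleftrightarrow>
     finite I \<and> int (card I) = skew_rank lam \<mu> \<and>
     disjoint_family_on (\<lambda>(u, v). {u, v}) I \<and>
     (\<forall>(u, v)\<in>I. u < v \<and> snake_label lam \<mu> u = Left_Snake \<and>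
        snake_label lam \<mu> v = Right_Snake)"

definition num_interval_sets :: "nat list \<Rightarrow> nat list \<Rightarrow> nat" where
  "num_interval_sets lam \<mu> = card {I. interval_set lam \<mu> I}"

end

theory Submission
  imports Defs "HOL-Library.FuncSet" "HOL-Combinatorics.Multiset_Permutations"
begin

text \<open>A partition is encoded by its beads \<open>\<alpha>\<^sub>i - i\<close>, the indices of the vertical steps of its
  boundary path. With \<open>A\<close> and \<open>B\<close> the beads of \<open>\<lambda>\<close> and \<open>\<mu>\<close>, the number \<open>N k\<close> of squares
  of content \<open>k\<close> changes by \<open>[k \<in> B] - [k \<in> A]\<close> from \<open>k\<close> to \<open>k + 1\<close>. Hence the left snakes are
  \<open>B - A\<close>, the right snakes are \<open>A - B\<close>, the rank is the cardinality of either set, and choosing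
  partners greedily from the left or from the right gives
  \<open>is = (\<Prod>v \<in> A - B. N v) = (\<Prod>u \<in> B - A. N (u + 1))\<close>.

  The snake of index \<open>k\<close> is a path through all squares of contents \<open>k\<close> and \<open>k + 1\<close>. A border strip
  decomposition amounts to a matching of adjacent squares in each snake, chosen independently, and
  is minimal iff all these matchings are maximum. A path with an even number of squares has one
  maximum matching; an odd one with \<open>2 n - 1\<close> squares has \<open>n\<close>, and \<open>n\<close> is \<open>N (k + 1)\<close> for left and
  \<open>N k\<close> for right snakes. The product of these numbers is \<open>is\<^sup>2\<close>. Adding a border strip moves one
  bead to the right, so a minimal tableau is an interval set with an ordering of its pairs.\<close>

section \<open>Partitions as sets of beads\<close>

text \<open>On the diagonal of content k the shape occupies an interval of rows whose two ends move
  by at most one from k to k + 1, so a snake is described by two row intervals. The matchings are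
  independent because a link between contents k and k + 1 restricts only successors on the one
  diagonal and predecessors on the other; no cycle can close, as content increases along links. The
  number of strips is the number of squares minus the number of links. Since N k + N (k + 1) is
  twice the smaller value plus the difference, r strips remain when all matchings are maximum. The
  square arises because left snakes contribute one copy of the number of interval sets and right
  snakes another. All orderings of moves occur because the sources of a shortest sequence are beads
  of \<open>mu\<close> alone and its targets beads of \<open>lam\<close> alone, so that no move
  blocks another.\<close>

definition beads :: "nat list \<Rightarrow> int set" where
  "beads \<alpha> = {part \<alpha> i - i | i. 1 \<le> i}"

text \<open>The lowest row that the partition reaches on the diagonal of content \<open>k\<close>,
  where every row is thought of as continued to the left of column 1. The continuation cancels in
  the difference of two such numbers.\<close>

definition cnt :: "nat list \<Rightarrow> int \<Rightarrow> int" where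
  "cnt \<alpha> k = int (card {i. 1 \<le> i \<and> k \<le> part \<alpha> i - i})"

lemma down_closed_eq_atLeastAtMost:
  fixes S :: "int set"
  assumes "finite S" "\<And>i. i \<in> S \<Longrightarrow> 1 \<le> i" "\<And>i i'. \<lbrakk>i \<in> S; 1 \<le> i'; i' \<le> i\<rbrakk> \<Longrightarrow> i' \<in> S"
  shows "S = {1..int (card S)}"
proof (cases "S = {}")
  case False
  have "S \<subseteq> {1..Max S}" using assms(1,2) by auto
  moreover have "{1..Max S} \<subseteq> S" using assms(3)[OF Max_in[OF assms(1) False]] by auto
  ultimately have eq: "S = {1..Max S}" by (rule subset_antisym)
  have "1 \<le> Max S" using assms(2) Max_in[OF assms(1) False] by blast
  moreover have "card S = card {1..Max S}" using eq by (rule arg_cong)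
  ultimately have "int (card S) = Max S" by (simp only: card_atLeastAtMost_int)
  then show ?thesis using eq by simp
qed simp

lemma bead_less:
  assumes "is_partition \<alpha>" "1 \<le> i" "i < i'"
  shows "part \<alpha> i' - i' < part \<alpha> i - i"
  using part_antimono[OF assms(1), of i i'] assms by simp

text \<open>Beads decrease strictly from row to row, so the rows counted by \<open>cnt\<close> are
  an initial segment. This equivalence translates between \<open>part\<close> and
  \<open>cnt\<close>.\<close>

lemma le_cnt_iff:
  assumes \<alpha>: "is_partition \<alpha>" and i: "1 \<le> i"
  shows "i \<le> cnt \<alpha> k \<longleftrightarrow> k \<le> part \<alpha> i - i"
proof -
  let ?S = "{i. 1 \<le> i \<and> k \<le> part \<alpha> i - i}"
  have "?S \<subseteq> {1..max (int (length \<alpha>)) (- k)}"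
    by (auto simp: Defs.part_def split: if_splits)
  then have fin: "finite ?S" by (rule finite_subset) simp
  have "?S = {1..int (card ?S)}"
  proof (rule down_closed_eq_atLeastAtMost[OF fin])
    fix j j' assume "j \<in> ?S" "1 \<le> j'" "j' \<le> j"
    then show "j' \<in> ?S" using bead_less[OF \<alpha>, of j' j] by (cases "j' = j") auto
  qed simp
  then have "i \<in> ?S \<longleftrightarrow> i \<in> {1..cnt \<alpha> k}" by (simp add: cnt_def)
  then show ?thesis using i by auto
qed

lemma cnt_nonneg: "0 \<le> cnt \<alpha> k"
  by (simp add: cnt_def)

lemma cnt_eqI:
  assumes "is_partition \<alpha>" "0 \<le> m" "\<And>i. 1 \<le> i \<Longrightarrow> k \<le> part \<alpha> i - i \<longleftrightarrow> i \<le> m"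
  shows "cnt \<alpha> k = m"
proof (rule antisym)
  show "cnt \<alpha> k \<le> m"
    using assms(3)[of "cnt \<alpha> k"] le_cnt_iff[OF assms(1), of "cnt \<alpha> k" k] assms(2)
    by (cases "1 \<le> cnt \<alpha> k") auto
  show "m \<le> cnt \<alpha> k"
    using assms(3)[of m] le_cnt_iff[OF assms(1), of m k] cnt_nonneg[of \<alpha> k]
    by (cases "1 \<le> m") auto
qed

text \<open>Raising the threshold from \<open>k\<close> to \<open>k + 1\<close> loses the row whose
  bead is \<open>k\<close>, and there is at most one such row.\<close>

lemma cnt_Suc:
  assumes \<alpha>: "is_partition \<alpha>"
  shows "cnt \<alpha> (k + 1) = cnt \<alpha> k - of_bool (k \<in> beads \<alpha>)"
proof (cases "k \<in> beads \<alpha>")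
  case True
  then obtain i where i: "1 \<le> i" "k = part \<alpha> i - i" by (auto simp: beads_def)
  have *: "k + 1 \<le> part \<alpha> j - j \<longleftrightarrow> j \<le> i - 1" if "1 \<le> j" for j
    using bead_less[OF \<alpha>, of j i] bead_less[OF \<alpha>, of i j] i that
    by (cases "j = i"; cases "j < i") auto
  have **: "k \<le> part \<alpha> j - j \<longleftrightarrow> j \<le> i" if "1 \<le> j" for j
    using bead_less[OF \<alpha>, of j i] bead_less[OF \<alpha>, of i j] i that
    by (cases "j = i"; cases "j < i") auto
  have "cnt \<alpha> (k + 1) = i - 1" using i * by (intro cnt_eqI[OF \<alpha>]) auto
  moreover have "cnt \<alpha> k = i" using i ** by (intro cnt_eqI[OF \<alpha>]) auto
  ultimately show ?thesis using True by simp
next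
  case False
  then have "k + 1 \<le> part \<alpha> j - j \<longleftrightarrow> k \<le> part \<alpha> j - j" if "1 \<le> j" for j
    using that by (force simp: beads_def)
  then have "cnt \<alpha> (k + 1) = cnt \<alpha> k" unfolding cnt_def by (metis (lifting))
  then show ?thesis using False by simp
qed

lemma cnt_large:
  assumes "is_partition \<alpha>" "part \<alpha> 1 \<le> k"
  shows "cnt \<alpha> k = 0"
proof (rule cnt_eqI[OF assms(1)])
  fix i :: int assume "1 \<le> i"
  then show "k \<le> part \<alpha> i - i \<longleftrightarrow> i \<le> 0" using part_antimono[OF assms(1), of 1 i] assms(2) by simp
qed simp

lemma cnt_small: "is_partition \<alpha> \<Longrightarrow> k \<le> - int (length \<alpha>) \<Longrightarrow> cnt \<alpha> k = - k"
  by (rule cnt_eqI) (auto simp: Defs.part_def)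

lemma contained_cnt_iff:
  assumes "is_partition \<alpha>" "is_partition \<beta>"
  shows "contained \<beta> \<alpha> \<longleftrightarrow> (\<forall>k. cnt \<beta> k \<le> cnt \<alpha> k)"
proof
  assume c: "contained \<beta> \<alpha>"
  show "\<forall>k. cnt \<beta> k \<le> cnt \<alpha> k"
  proof
    fix k
    show "cnt \<beta> k \<le> cnt \<alpha> k"
    proof (cases "1 \<le> cnt \<beta> k")
      case True
      then have "k \<le> part \<beta> (cnt \<beta> k) - cnt \<beta> k" using le_cnt_iff[OF assms(2)] by blast
      then have "k \<le> part \<alpha> (cnt \<beta> k) - cnt \<beta> k" using c True unfolding contained_def by force
      then show ?thesis using le_cnt_iff[OF assms(1) True] by blast
    next
      case False then show ?thesis using cnt_nonneg[of \<alpha> k] by linarith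
    qed
  qed
next
  assume c: "\<forall>k. cnt \<beta> k \<le> cnt \<alpha> k"
  show "contained \<beta> \<alpha>" unfolding contained_def
  proof (intro allI impI)
    fix i :: int assume i: "1 \<le> i"
    have "i \<le> cnt \<beta> (part \<beta> i - i)" using le_cnt_iff[OF assms(2) i] by blast
    then have "i \<le> cnt \<alpha> (part \<beta> i - i)" using c order_trans by blast
    then show "part \<beta> i \<le> part \<alpha> i" using le_cnt_iff[OF assms(1) i] by auto
  qed
qed

text \<open>Zero entries are excluded, so the last entry is the last positive part and the parts fix
  the length of the list.\<close>

lemma part_inject:
  assumes "is_partition \<alpha>" "is_partition \<beta>" "\<And>i. 1 \<le> i \<Longrightarrow> part \<alpha> i = part \<beta> i"
  shows "\<alpha> = \<beta>"
proof -
  have le: "length \<gamma> \<le> length \<delta>" if "is_partition \<gamma>" "\<And>i. 1 \<le> i \<Longrightarrow> part \<gamma> i = part \<delta> i" for \<gamma> \<delta>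
  proof (rule ccontr)
    assume n: "\<not> length \<gamma> \<le> length \<delta>"
    then have "part \<gamma> (int (length \<gamma>)) = 0" using that(2)[of "int (length \<gamma>)"]
      by (simp add: Defs.part_def)
    then have "\<gamma> ! (length \<gamma> - 1) = 0" using n by (simp add: Defs.part_def nat_diff_distrib split: if_splits)
    then show False using that(1) n unfolding is_partition_def
      by (metis diff_less le0 le_less_trans linorder_not_le nth_mem zero_less_one)
  qed
  show ?thesis
  proof (rule nth_equalityI)
    show l: "length \<alpha> = length \<beta>" using le assms by (metis antisym)
    fix n assume "n < length \<alpha>"
    then show "\<alpha> ! n = \<beta> ! n" using assms(3)[of "int n + 1"] l by (simp add: Defs.part_def)
  qed
qed

lemma partition_eqI_cnt:
  assumes "is_partition \<alpha>" "is_partition \<beta>" "\<And>k. cnt \<alpha> k = cnt \<beta> k"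
  shows "\<alpha> = \<beta>"
proof (rule part_inject[OF assms(1,2)])
  have "contained \<alpha> \<beta>" "contained \<beta> \<alpha>" using assms contained_cnt_iff by auto
  then show "part \<alpha> i = part \<beta> i" if "1 \<le> i" for i using that unfolding contained_def by force
qed

lemma cnt_eq_card_beads:
  assumes \<alpha>: "is_partition \<alpha>"
  shows "cnt \<alpha> k = int (card {x \<in> beads \<alpha>. k \<le> x})"
proof -
  have "inj_on (\<lambda>i. part \<alpha> i - i) {i. 1 \<le> i \<and> k \<le> part \<alpha> i - i}"
    using bead_less[OF \<alpha>] by (intro linorder_inj_onI') force
  from card_image[OF this]
  have "card {i. 1 \<le> i \<and> k \<le> part \<alpha> i - i} = card ((\<lambda>i. part \<alpha> i - i) ` {i. 1 \<le> i \<and> k \<le> part \<alpha> i - i})"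
    by simp
  also have "(\<lambda>i. part \<alpha> i - i) ` {i. 1 \<le> i \<and> k \<le> part \<alpha> i - i} = {x \<in> beads \<alpha>. k \<le> x}"
    by (auto simp: beads_def)
  finally show ?thesis by (simp add: cnt_def)
qed

lemma beads_inject:
  assumes "is_partition \<alpha>" "is_partition \<beta>" "beads \<alpha> = beads \<beta>"
  shows "\<alpha> = \<beta>"
  by (rule partition_eqI_cnt) (use assms in \<open>auto simp: cnt_eq_card_beads\<close>)

section \<open>Partitions from diagrams and from counting functions\<close>

text \<open>The row lengths of \<open>Q\<close> are the parts. The list stops after as many rows as
  the first column has squares, which keeps zeros out of it.\<close>

lemma ex_partition_of_diagram:
  assumes fin: "finite Q"
    and pos: "\<And>i j. (i, j) \<in> Q \<Longrightarrow> 1 \<le> i \<and> 1 \<le> j"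
    and dc: "\<And>i j i' j'. \<lbrakk>(i, j) \<in> Q; 1 \<le> i'; i' \<le> i; 1 \<le> j'; j' \<le> j\<rbrakk> \<Longrightarrow> (i', j') \<in> Q"
  shows "\<exists>\<alpha>. is_partition \<alpha> \<and> diagram \<alpha> = Q"
proof -
  define row where "row i = card {j. (i, j) \<in> Q}" for i
  define n where "n = card {i. (i, 1) \<in> Q}"
  have fr: "finite {j. (i, j) \<in> Q}" for i
    by (rule finite_subset[of _ "snd ` Q"]) (use fin in force)+
  have row: "(i, j) \<in> Q \<longleftrightarrow> 1 \<le> j \<and> j \<le> int (row i)" for i j
  proof -
    have "{j. (i, j) \<in> Q} = {1..int (row i)}" unfolding row_def
    proof (rule down_closed_eq_atLeastAtMost[OF fr])
      fix j j' assume "j \<in> {j. (i, j) \<in> Q}" "1 \<le> j'" "j' \<le> j"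
      then show "j' \<in> {j. (i, j) \<in> Q}" using dc[of i j i j'] pos[of i j] by simp
    qed (use pos in auto)
    then have "j \<in> {j. (i, j) \<in> Q} \<longleftrightarrow> j \<in> {1..int (row i)}" by simp
    then show ?thesis by simp
  qed
  have col: "(i, 1) \<in> Q \<longleftrightarrow> 1 \<le> i \<and> i \<le> int n" for i
  proof -
    have "{i. (i, 1) \<in> Q} = {1..int n}" unfolding n_def
    proof (rule down_closed_eq_atLeastAtMost)
      show "finite {i. (i, 1) \<in> Q}"
        by (rule finite_subset[of _ "fst ` Q"]) (use fin in force)+
      fix j j' assume "j \<in> {j. (j, 1) \<in> Q}" "1 \<le> j'" "j' \<le> j"
      then show "j' \<in> {j. (j, 1) \<in> Q}" using dc[of j 1 j' 1] by simp
    qed (use pos in auto)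
    then have "i \<in> {i. (i, 1) \<in> Q} \<longleftrightarrow> i \<in> {1..int n}" by simp
    then show ?thesis by simp
  qed
  have row_pos: "0 < row i \<longleftrightarrow> 1 \<le> i \<and> i \<le> int n" for i
    using row[of i 1] col[of i] by auto
  have row_mono: "row i' \<le> row i" if "1 \<le> i" "i \<le> i'" for i i'
    using row[of i' "int (row i')"] row[of i "int (row i')"] dc[of i' "int (row i')" i "int (row i')"] that
    by (cases "row i' = 0") auto
  define \<alpha> where "\<alpha> = map (\<lambda>i. row (int i + 1)) [0..<n]"
  have part: "part \<alpha> i = int (row i)" if "1 \<le> i" for i
    using that row_pos[of i] by (auto simp: Defs.part_def \<alpha>_def)
  have "is_partition \<alpha>" unfolding is_partition_def
  proof
    show "sorted_wrt (\<ge>) \<alpha>"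
      unfolding \<alpha>_def sorted_wrt_map sorted_wrt_iff_nth_less by (auto intro: row_mono)
    show "0 \<notin> set \<alpha>" 
    proof -
      have "0 < row (int i + 1)" if "i < n" for i using row_pos[of "int i + 1"] that by simp
      then show ?thesis by (auto simp: \<alpha>_def) (metis less_irrefl)
    qed
  qed
  moreover have "diagram \<alpha> = Q"
  proof (rule set_eqI, clarify)
    fix i j show "(i, j) \<in> diagram \<alpha> \<longleftrightarrow> (i, j) \<in> Q"
      unfolding mem_diagram using row[of i j] part[of i] pos[of i j] by auto
  qed
  ultimately show ?thesis by blast
qed

text \<open>The hypotheses characterise the functions \<open>cnt \<alpha>\<close>: each bead lowers
  the value by one, far to the right there are no beads, far to the left every integer is
  one.\<close>

lemma ex_partition_of_cnt:
  assumes step: "\<And>k. c (k + 1) = c k \<or> c (k + 1) = c k - 1"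
    and large: "\<And>k. k1 \<le> k \<Longrightarrow> c k = 0"
    and small: "\<And>k. k \<le> k0 \<Longrightarrow> c k = - k"
  shows "\<exists>\<alpha>. is_partition \<alpha> \<and> (\<forall>k. cnt \<alpha> k = c k)"
proof -
  have anti: "c k' \<le> c k" if "k \<le> k'" for k k'
    using that
  proof (induction k' rule: int_ge_induct)
    case (step k') then show ?case using assms(1)[of k'] by linarith
  qed simp
  have mono: "c k + k \<le> c k' + k'" if "k \<le> k'" for k k'
    using that
  proof (induction k' rule: int_ge_induct)
    case (step k') then show ?case using assms(1)[of k'] by linarith
  qed simp
  have nonneg: "0 \<le> c k" for k using anti[of k "max k k1"] large by simp
  have ge: "- k \<le> c k" for k using mono[of "min k k0" k] small[of "min k k0"] by simp
  \<comment> \<open>A square is taken if its row is at most the count on its diagonal. Shrinking the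
    column uses that \<open>c\<close> is antitone, shrinking the row that \<open>c k + k\<close> is
    monotone.\<close>
  define Q where "Q = {(i, j). 1 \<le> i \<and> 1 \<le> j \<and> i \<le> c (j - i)}"
  have "\<exists>\<alpha>. is_partition \<alpha> \<and> diagram \<alpha> = Q"
  proof (rule ex_partition_of_diagram)
    have "Q \<subseteq> {1..c k0} \<times> {1..k1 + c k0}"
    proof clarify
      fix i j assume "(i, j) \<in> Q"
      then have *: "1 \<le> i" "1 \<le> j" "i \<le> c (j - i)" by (auto simp: Q_def)
      have "k0 \<le> j - i" using small[of "j - i"] * by linarith
      moreover have "j - i < k1" using large[of "j - i"] * by force
      moreover have "i \<le> c k0" using anti \<open>k0 \<le> j - i\<close> * order_trans by blast
      ultimately show "i \<in> {1..c k0} \<and> j \<in> {1..k1 + c k0}" using * by auto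
    qed
    then show "finite Q" by (rule finite_subset) simp
    fix i j i' j' assume "(i, j) \<in> Q" "1 \<le> i'" "i' \<le> i" "1 \<le> j'" "j' \<le> j"
    then show "(i', j') \<in> Q"
      using anti[of "j' - i" "j - i"] mono[of "j' - i" "j' - i'"] by (auto simp: Q_def)
  qed (auto simp: Q_def)
  then obtain \<alpha> where \<alpha>: "is_partition \<alpha>" "diagram \<alpha> = Q" by blast
  have "cnt \<alpha> k = c k" for k
  proof (rule cnt_eqI[OF \<alpha>(1) nonneg])
    fix i :: int assume i: "1 \<le> i"
    show "k \<le> part \<alpha> i - i \<longleftrightarrow> i \<le> c k"
    proof (cases "1 \<le> i + k")
      case True
      have "k \<le> part \<alpha> i - i \<longleftrightarrow> (i, i + k) \<in> diagram \<alpha>"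
        using i True by (auto simp: mem_diagram)
      then show ?thesis using i True by (simp add: \<alpha>(2) Q_def)
    next
      case False
      then show ?thesis using ge[of k] part_nonneg[of \<alpha> i] by auto
    qed
  qed
  then show ?thesis using \<alpha> by blast
qed

text \<open>The added strip has one square on each diagonal with \<open>u < k \<le> v\<close>, so
  \<open>cnt\<close> rises by one there. Right after \<open>u\<close> the rise cancels the old drop,
  and its end after \<open>v\<close> creates a new drop, which is the moved bead.\<close>

lemma ex_partition_move_bead:
  assumes \<alpha>: "is_partition \<alpha>" and u: "u \<in> beads \<alpha>" and v: "v \<notin> beads \<alpha>" and "u < v"
  shows "\<exists>\<beta>. is_partition \<beta> \<and> contained \<alpha> \<beta> \<and> beads \<beta> = insert v (beads \<alpha> - {u})"
proof -
  have "\<exists>\<beta>. is_partition \<beta> \<and> (\<forall>k. cnt \<beta> k = cnt \<alpha> k + of_bool (u < k \<and> k \<le> v))"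
  proof (rule ex_partition_of_cnt)
    fix k show "cnt \<alpha> (k + 1) + of_bool (u < k + 1 \<and> k + 1 \<le> v) = cnt \<alpha> k + of_bool (u < k \<and> k \<le> v) \<or>
      cnt \<alpha> (k + 1) + of_bool (u < k + 1 \<and> k + 1 \<le> v) = cnt \<alpha> k + of_bool (u < k \<and> k \<le> v) - 1"
      using u v cnt_Suc[OF \<alpha>, of k] by (cases "k = u"; cases "k = v") auto
  next
    fix k assume "max (part \<alpha> 1) (v + 1) \<le> k"
    then show "cnt \<alpha> k + of_bool (u < k \<and> k \<le> v) = 0" using cnt_large[OF \<alpha>] by auto
  next
    fix k assume "k \<le> min (- int (length \<alpha>)) u"
    then show "cnt \<alpha> k + of_bool (u < k \<and> k \<le> v) = - k" using cnt_small[OF \<alpha>] by auto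
  qed
  then obtain \<beta> where \<beta>: "is_partition \<beta>" "\<And>k. cnt \<beta> k = cnt \<alpha> k + of_bool (u < k \<and> k \<le> v)" by blast
  have "k \<in> beads \<beta> \<longleftrightarrow> k \<in> insert v (beads \<alpha> - {u})" for k
    using cnt_Suc[OF \<alpha>, of k] cnt_Suc[OF \<beta>(1), of k] \<beta>(2)[of k] \<beta>(2)[of "k + 1"] u v \<open>u < v\<close>
    by (auto simp: of_bool_def split: if_splits)
  moreover have "contained \<alpha> \<beta>" using contained_cnt_iff[OF \<beta>(1) \<alpha>] \<beta>(2) by simp
  ultimately show ?thesis using \<beta>(1) by blast
qed

section \<open>Contents of a skew diagram\<close>

definition content :: "square \<Rightarrow> int" where
  "content s = snd s - fst s"

lemma content_pair [simp]: "content (i, j) = j - i"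
  by (simp add: content_def)

locale skew_shape =
  fixes lam mu :: "nat list"
  assumes part_lam: "is_partition lam" and part_mu: "is_partition mu"
    and cont: "contained mu lam"
begin

abbreviation D where "D \<equiv> skew lam mu"

definition N :: "int \<Rightarrow> int" where
  "N k = cnt lam k - cnt mu k"

abbreviation Lset where "Lset \<equiv> beads mu - beads lam"
abbreviation Rset where "Rset \<equiv> beads lam - beads mu"

text \<open>The margin of one on either side makes \<open>N\<close> vanish at \<open>lo\<close>,
  \<open>lo + 1\<close>, \<open>hi - 1\<close> and \<open>hi\<close>, so sums over
  \<open>{lo..hi}\<close> can be shifted by one without boundary terms.\<close>

definition lo :: int where "lo = - int (max (length lam) (length mu)) - 1"
definition hi :: int where "hi = max (part lam 1) (part mu 1) + 1"

lemma N_nonneg: "0 \<le> N k"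
  using cont contained_cnt_iff[OF part_lam part_mu] by (simp add: N_def)

lemma N_Suc: "N (k + 1) = N k + of_bool (k \<in> beads mu) - of_bool (k \<in> beads lam)"
  by (simp add: N_def cnt_Suc part_lam part_mu)

lemma N_low: "k \<le> lo + 1 \<Longrightarrow> N k = 0"
  by (simp add: N_def lo_def cnt_small part_lam part_mu)

lemma N_high: "hi - 1 \<le> k \<Longrightarrow> N k = 0"
  by (simp add: N_def hi_def cnt_large part_lam part_mu)

lemma mem_D: "(i, j) \<in> D \<longleftrightarrow> cnt mu (j - i) < i \<and> i \<le> cnt lam (j - i)"
proof (cases "1 \<le> i")
  case True
  then show ?thesis
    using le_cnt_iff[OF part_lam True, of "j - i"] le_cnt_iff[OF part_mu True, of "j - i"]
    by (auto simp: skew_def)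
next
  case False
  then show ?thesis using cnt_nonneg[of mu "j - i"] by (auto simp: skew_def)
qed

lemma mem_D_content: "(i, i + k) \<in> D \<longleftrightarrow> cnt mu k < i \<and> i \<le> cnt lam k"
  by (simp add: mem_D)

lemma D_content_eq: "{s \<in> D. content s = k} = (\<lambda>i. (i, i + k)) ` {cnt mu k<..cnt lam k}"
  by (auto simp: mem_D image_iff)

lemma card_D_content: "int (card {s \<in> D. content s = k}) = N k"
proof -
  have "inj (\<lambda>i::int. (i, i + k))" by (auto intro: injI)
  then have "card {s \<in> D. content s = k} = card {cnt mu k<..cnt lam k}"
    unfolding D_content_eq by (rule card_image[OF inj_on_subset]) simp
  then show ?thesis using N_nonneg[of k] by (simp add: N_def)
qed

lemma content_range:
  assumes "s \<in> D" shows "lo < content s" "content s < hi"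
proof -
  obtain i j where s: "s = (i, j)" by (cases s)
  have "0 < N (j - i)" using assms mem_D[of i j] by (simp add: N_def s)
  then show "lo < content s" "content s < hi"
    using N_low[of "j - i"] N_high[of "j - i"] by (force simp: s)+
qed

lemma finite_D: "finite D"
proof (rule finite_subset)
  show "D \<subseteq> (\<Union>k\<in>{lo..hi}. {s \<in> D. content s = k})"
    using content_range by force
  show "finite (\<Union>k\<in>{lo..hi}. {s \<in> D. content s = k})"
    unfolding D_content_eq by simp
qed

lemma not_boundary:
  assumes "k \<in> Lset \<or> k \<in> Rset" shows "lo < k" "k < hi"
proof -
  have "N (k + 1) \<noteq> N k" using assms N_Suc[of k] by auto
  then show "lo < k" "k < hi" using N_low[of k] N_low[of "k + 1"] N_high[of k] N_high[of "k + 1"]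
    by force+
qed

lemma finite_Lset: "finite Lset" and finite_Rset: "finite Rset"
  by (rule finite_subset[of _ "{lo..hi}"], use not_boundary in force, simp)+

text \<open>\<open>N\<close> starts at 0 and changes by one exactly at the elements of
  \<open>Lset\<close> and \<open>Rset\<close>. For any interval set, \<open>N c\<close> is the
  number of its pairs with \<open>u < c \<le> v\<close>.\<close>

lemma N_eq_below: "N c = int (card {u \<in> Lset. u < c}) - int (card {v \<in> Rset. v < c})"
proof (cases "lo \<le> c")
  case True
  then show ?thesis
  proof (induction c rule: int_ge_induct)
    case base
    have "{u \<in> Lset. u < lo} = {}" "{v \<in> Rset. v < lo} = {}" using not_boundary by force+
    then show ?case using N_low[of lo] by (simp only: card.empty)
  next
    case (step c)
    have *: "card {u \<in> S. u < c + 1} = card {u \<in> S. u < c} + of_bool (c \<in> S)"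
      if "finite S" for S :: "int set"
    proof (cases "c \<in> S")
      case True
      then have "{u \<in> S. u < c + 1} = insert c {u \<in> S. u < c}" by auto
      then show ?thesis using True that by simp
    next
      case False
      then have "{u \<in> S. u < c + 1} = {u \<in> S. u < c}" by (force simp: order_less_le)
      then show ?thesis using False by simp
    qed
    show ?case
      unfolding *[OF finite_Lset] *[OF finite_Rset] N_Suc step.IH by (auto simp: of_bool_def)
  qed
next
  case False
  then have "{u \<in> Lset. u < c} = {}" "{v \<in> Rset. v < c} = {}" using not_boundary by force+
  then show ?thesis using N_low[of c] False by (simp only: card.empty)
qed

lemma card_Lset_Rset: "card Lset = card Rset"
proof -
  have "{u \<in> Lset. u < hi} = Lset" "{v \<in> Rset. v < hi} = Rset" using not_boundary by force+
  then show ?thesis using N_eq_below[of hi] N_high[of hi] by simp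
qed

text \<open>Complementation in two sets of equal size. This form matches the greedy choice from the
  right.\<close>

lemma N_eq_above: "N c = int (card {v \<in> Rset. c \<le> v}) - int (card {u \<in> Lset. c \<le> u})"
proof -
  have *: "card {u \<in> S. u < c} + card {u \<in> S. c \<le> u} = card S" if "finite S" for S :: "int set"
  proof -
    have "card ({u \<in> S. u < c} \<union> {u \<in> S. c \<le> u}) = card {u \<in> S. u < c} + card {u \<in> S. c \<le> u}"
      using that by (intro card_Un_disjoint) auto
    moreover have "{u \<in> S. u < c} \<union> {u \<in> S. c \<le> u} = S" by auto
    ultimately show ?thesis by simp
  qed
  show ?thesis using *[OF finite_Lset] *[OF finite_Rset] card_Lset_Rset N_eq_below[of c] by linarith
qed

section \<open>The rank\<close>

lemma diagonal_of_top:
  assumes c: "(i, j) \<in> D" and top: "\<And>i'. (i', i' + (j - i)) \<in> D \<Longrightarrow> i \<le> i'"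
  shows "diagonal D (i, j) = {s \<in> D. content s = j - i}"
proof (rule set_eqI)
  fix s :: square
  obtain a b where s: "s = (a, b)" by (cases s)
  show "s \<in> diagonal D (i, j) \<longleftrightarrow> s \<in> {s \<in> D. content s = j - i}"
  proof
    assume "s \<in> {s \<in> D. content s = j - i}"
    then have *: "b - a = j - i" "(a, b) \<in> D" by (auto simp: s)
    then have "b = a + (j - i)" by simp
    then have "i \<le> a" using top[of a] *(2) by simp
    then show "s \<in> diagonal D (i, j)" unfolding diagonal_def using *
      by (auto simp: s intro: exI[of _ "a - i"])
  qed (auto simp: diagonal_def)
qed

lemma beads_between:
  assumes \<alpha>: "is_partition \<alpha>" and "1 \<le> i" "part \<alpha> (i + 1) - (i + 1) < c" "c < part \<alpha> i - i"
  shows "c \<notin> beads \<alpha>"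
proof
  assume "c \<in> beads \<alpha>"
  then obtain m where m: "1 \<le> m" "c = part \<alpha> m - m" by (auto simp: beads_def)
  show False
  proof (cases "m \<le> i")
    case True then show False using bead_less[OF \<alpha> m(1), of i] assms m by (cases "m = i") auto
  next
    case False then show False using bead_less[OF \<alpha>, of "i + 1" m] assms m by (cases "m = i + 1") auto
  qed
qed

lemma beads_le_first: "is_partition \<alpha> \<Longrightarrow> c \<in> beads \<alpha> \<Longrightarrow> c \<le> part \<alpha> 1 - 1"
  using part_antimono[of \<alpha> 1] by (fastforce simp: beads_def)

text \<open>At an outside corner of content \<open>c\<close> the path of \<open>mu\<close> goes up
  the left edge and then along the upper edge, its steps \<open>c - 1\<close> and \<open>c\<close>.
  Conversely, such a turn makes the top square of the diagonal an outside corner whenever the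
  diagonal meets the shape.\<close>

lemma outside_diagonals:
  "(\<Union>c\<in>outside_top_corners D. diagonal D c) =
     {s \<in> D. content s - 1 \<in> beads mu \<and> content s \<notin> beads mu}"
proof (rule set_eqI, rule iffI)
  fix s assume "s \<in> (\<Union>c\<in>outside_top_corners D. diagonal D c)"
  then obtain i j where ij: "(i, j) \<in> D" "(i - 1, j) \<notin> D" "(i, j - 1) \<notin> D" "s \<in> diagonal D (i, j)"
    by (auto simp: outside_top_corners_def)
  have s: "s \<in> D" "content s = j - i" using ij(4) by (auto simp: diagonal_def)
  have i: "1 \<le> i" "part mu i < j" "j \<le> part lam i" using ij(1) by (auto simp: skew_def)
  have "part mu i = j - 1" using ij(3) i by (auto simp: skew_def)
  then have "j - i - 1 \<in> beads mu" using i(1) unfolding beads_def by (intro CollectI exI[of _ i]) simp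
  moreover have "j - i \<notin> beads mu"
  proof (cases "i = 1")
    case True then show ?thesis using beads_le_first[OF part_mu] \<open>part mu i = j - 1\<close> by force
  next
    case False
    then have "j \<le> part mu (i - 1)"
      using ij(2) i part_antimono[OF part_lam, of "i - 1" i] by (auto simp: skew_def)
    then show ?thesis using beads_between[OF part_mu, of "i - 1" "j - i"] i False by auto
  qed
  ultimately show "s \<in> {s \<in> D. content s - 1 \<in> beads mu \<and> content s \<notin> beads mu}" using s by auto
next
  fix s assume "s \<in> {s \<in> D. content s - 1 \<in> beads mu \<and> content s \<notin> beads mu}"
  then have s: "s \<in> D" "content s - 1 \<in> beads mu" "content s \<notin> beads mu" by auto
  define c where "c = content s"
  define i where "i = cnt mu c + 1"
  have i1: "1 \<le> i" using cnt_nonneg[of mu c] by (simp add: i_def)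
  have "(fst s, fst s + c) \<in> D" using s(1) by (simp add: c_def content_def)
  then have ne: "cnt mu c < cnt lam c" by (simp add: mem_D_content)
  then have inD: "(i, i + c) \<in> D" by (simp add: mem_D_content i_def)
  have a: "cnt mu (c - 1) = i" "cnt mu (c + 1) = i - 1"
    using cnt_Suc[OF part_mu, of "c - 1"] cnt_Suc[OF part_mu, of c] s by (auto simp: c_def i_def)
  have "(i, i + c) \<in> outside_top_corners D"
    using inD a by (auto simp: outside_top_corners_def mem_D algebra_simps)
  moreover have "diagonal D (i, i + c) = {s \<in> D. content s = c}"
    using diagonal_of_top[OF inD] by (auto simp: mem_D i_def)
  ultimately show "s \<in> (\<Union>c\<in>outside_top_corners D. diagonal D c)"
    using s(1) by (intro UN_I[of "(i, i + c)"]) (auto simp: c_def)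
qed

text \<open>The opposite turn: steps \<open>c - 1\<close> and \<open>c\<close> of the path of
  \<open>mu\<close> are the lower and the right edge of the square diagonally before the
  corner.\<close>

lemma inside_diagonals:
  "(\<Union>c\<in>inside_top_corners D. diagonal D c) =
     {s \<in> D. content s - 1 \<notin> beads mu \<and> content s \<in> beads mu}"
proof (rule set_eqI, rule iffI)
  fix s assume "s \<in> (\<Union>c\<in>inside_top_corners D. diagonal D c)"
  then obtain i j where ij: "(i, j) \<in> D" "(i - 1, j) \<in> D" "(i, j - 1) \<in> D" "(i - 1, j - 1) \<notin> D"
    "s \<in> diagonal D (i, j)"
    by (auto simp: inside_top_corners_def)
  have s: "s \<in> D" "content s = j - i" using ij(5) by (auto simp: diagonal_def)
  have "part mu (i - 1) = j - 1" "1 \<le> i - 1" using ij by (auto simp: skew_def)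
  then have "j - i \<in> beads mu" unfolding beads_def by (intro CollectI exI[of _ "i - 1"]) simp
  moreover have "j - i - 1 \<notin> beads mu"
    using beads_between[OF part_mu, of "i - 1" "j - i - 1"] \<open>part mu (i - 1) = j - 1\<close> \<open>1 \<le> i - 1\<close>
      ij(3) by (auto simp: skew_def)
  ultimately show "s \<in> {s \<in> D. content s - 1 \<notin> beads mu \<and> content s \<in> beads mu}" using s by auto
next
  fix s assume "s \<in> {s \<in> D. content s - 1 \<notin> beads mu \<and> content s \<in> beads mu}"
  then have s: "s \<in> D" "content s - 1 \<notin> beads mu" "content s \<in> beads mu" by auto
  define c where "c = content s"
  define i where "i = cnt mu c + 1"
  have "(fst s, fst s + c) \<in> D" using s(1) by (simp add: c_def content_def)
  then have ne: "cnt mu c < cnt lam c" by (simp add: mem_D_content)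
  then have inD: "(i, i + c) \<in> D" by (simp add: mem_D_content i_def)
  have a: "cnt mu (c - 1) = i - 1" "cnt mu (c + 1) = i - 2"
    using cnt_Suc[OF part_mu, of "c - 1"] cnt_Suc[OF part_mu, of c] s by (auto simp: c_def i_def)
  \<comment> \<open>The squares to the left of and above the corner lie in \<open>lam\<close>
    because \<open>cnt lam\<close> is antitone and drops by at most one.\<close>
  have b: "i \<le> cnt lam (c - 1)" "i - 1 \<le> cnt lam (c + 1)"
    using cnt_Suc[OF part_lam, of "c - 1"] cnt_Suc[OF part_lam, of c] ne
    by (auto simp: i_def of_bool_def split: if_splits)
  have "(i, i + c) \<in> inside_top_corners D"
    using inD a b by (auto simp: inside_top_corners_def mem_D algebra_simps) (auto simp: i_def)
  moreover have "diagonal D (i, i + c) = {s \<in> D. content s = c}"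
    using diagonal_of_top[OF inD] by (auto simp: mem_D i_def)
  ultimately show "s \<in> (\<Union>c\<in>inside_top_corners D. diagonal D c)"
    using s(1) by (intro UN_I[of "(i, i + c)"]) (auto simp: c_def)
qed

lemma sum_by_content:
  fixes f :: "int \<Rightarrow> int"
  shows "(\<Sum>s\<in>D. f (content s)) = (\<Sum>k\<in>{lo..hi}. N k * f k)"
proof -
  have "(\<Sum>s\<in>D. f (content s)) = (\<Sum>k\<in>{lo..hi}. \<Sum>s\<in>{s \<in> D. content s = k}. f (content s))"
    using content_range by (intro sum.group[symmetric] finite_D) force+
  also have "\<dots> = (\<Sum>k\<in>{lo..hi}. N k * f k)"
    using card_D_content by (intro sum.cong) auto
  finally show ?thesis .
qed

lemma card_filter_int: "finite S \<Longrightarrow> int (card {s \<in> S. P s}) = (\<Sum>s\<in>S. of_bool (P s))"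
  by (simp add: of_bool_def sum.If_cases Int_def)

text \<open>For a square of content \<open>c\<close>, outside minus inside is
  \<open>[c - 1 \<in> beads mu] - [c \<in> beads mu]\<close>. Summation by parts moves the
  difference onto \<open>N\<close>, and at a bead \<open>k\<close> of \<open>mu\<close> the
  increment \<open>N (k + 1) - N k\<close> is 1 if \<open>k\<close> is not a bead of
  \<open>lam\<close> and 0 otherwise.\<close>

lemma rank_eq: "skew_rank lam mu = int (card Lset)"
proof -
  have "skew_rank lam mu =
      (\<Sum>s\<in>D. of_bool (content s - 1 \<in> beads mu) - of_bool (content s \<in> beads mu))"
    unfolding skew_rank_def Let_def outside_diagonals inside_diagonals card_filter_int[OF finite_D]
    by (subst sum_subtractf[symmetric], rule sum.cong) auto
  also have "\<dots> = (\<Sum>k\<in>{lo..hi}. N k * (of_bool (k - 1 \<in> beads mu) - of_bool (k \<in> beads mu)))"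
    by (rule sum_by_content)
  also have "\<dots> = (\<Sum>k\<in>{lo..hi}. N k * of_bool (k - 1 \<in> beads mu)) -
      (\<Sum>k\<in>{lo..hi}. N k * of_bool (k \<in> beads mu))"
    by (simp add: right_diff_distrib sum_subtractf)
  also have "(\<Sum>k\<in>{lo..hi}. N k * of_bool (k - 1 \<in> beads mu)) =
      (\<Sum>k\<in>{lo-1..hi-1}. N (k + 1) * of_bool (k \<in> beads mu))"
    by (rule sum.reindex_bij_witness[of _ "\<lambda>k. k + 1" "\<lambda>k. k - 1"]) auto
  also have "\<dots> = (\<Sum>k\<in>{lo..hi}. N (k + 1) * of_bool (k \<in> beads mu))"
    by (rule sum.mono_neutral_cong) (auto intro: N_low N_high)
  also have "\<dots> - (\<Sum>k\<in>{lo..hi}. N k * of_bool (k \<in> beads mu)) =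
      (\<Sum>k\<in>{lo..hi}. of_bool (k \<in> Lset))"
    unfolding sum_subtractf[symmetric] by (rule sum.cong) (auto simp: N_Suc)
  also have "\<dots> = int (card {k \<in> {lo..hi}. k \<in> Lset})"
    by (rule card_filter_int[symmetric]) simp
  also have "{k \<in> {lo..hi}. k \<in> Lset} = Lset" using not_boundary by force
  finally show ?thesis .
qed

section \<open>Snakes\<close>

text \<open>The path finally runs along \<open>y = 0\<close> and each vertical step climbs by one,
  so before step \<open>k\<close> the height still to climb is the number of beads from
  \<open>k\<close> on, which is \<open>cnt \<alpha> k\<close>.\<close>

lemma Horizontal_in_path_iff:
  assumes \<alpha>: "is_partition \<alpha>"
  shows "Horizontal x y \<in> boundary_path \<alpha> \<longleftrightarrow> x + y \<notin> beads \<alpha> \<and> - y = cnt \<alpha> (x + y)"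
proof -
  have 1: "Horizontal x y \<in> boundary_path \<alpha> \<longleftrightarrow> 0 \<le> - y \<and> 1 \<le> x + 1 \<and>
      (- y = 0 \<or> (- y, x + 1) \<in> diagram \<alpha>) \<and> (- y + 1, x + 1) \<notin> diagram \<alpha>"
    unfolding boundary_path_def
    by (rule iffI, fastforce, rule UnI1, rule CollectI, rule exI[of _ "- y"],
        rule exI[of _ "x + 1"], simp)
  have eq1: "- y \<le> cnt \<alpha> (x + y + 1) \<longleftrightarrow> x + 1 \<le> part \<alpha> (- y)" if "1 \<le> - y"
    using le_cnt_iff[OF \<alpha> that, of "x + y + 1"] by auto
  have eq2: "- y + 1 \<le> cnt \<alpha> (x + y) \<longleftrightarrow> x + 1 \<le> part \<alpha> (- y + 1)" if "1 \<le> - y + 1"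
    using le_cnt_iff[OF \<alpha> that, of "x + y"] by auto
  have x: "0 \<le> x" if "- y = cnt \<alpha> (x + y)"
    using that le_cnt_iff[OF \<alpha>, of "- y + 1" "x + y"] cnt_nonneg[of \<alpha> "x + y"]
      part_nonneg[of \<alpha> "- y + 1"] by auto
  have cs: "cnt \<alpha> (x + y + 1) = cnt \<alpha> (x + y) - of_bool (x + y \<in> beads \<alpha>)" by (rule cnt_Suc[OF \<alpha>])
  show ?thesis
  proof
    assume h: "Horizontal x y \<in> boundary_path \<alpha>"
    then have "0 \<le> - y" "0 \<le> x" using 1 by auto
    moreover have "- y \<le> cnt \<alpha> (x + y + 1)" using h 1 eq1 cnt_nonneg[of \<alpha> "x + y + 1"]
      by (cases "y = 0") (auto simp: mem_diagram)
    moreover have "\<not> - y + 1 \<le> cnt \<alpha> (x + y)" using h 1 eq2 by (auto simp: mem_diagram)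
    ultimately show "x + y \<notin> beads \<alpha> \<and> - y = cnt \<alpha> (x + y)" using cs
      by (auto simp: of_bool_def split: if_splits)
  next
    assume h: "x + y \<notin> beads \<alpha> \<and> - y = cnt \<alpha> (x + y)"
    then have "0 \<le> - y" "0 \<le> x" using x cnt_nonneg[of \<alpha> "x + y"] by auto
    then show "Horizontal x y \<in> boundary_path \<alpha>" unfolding 1 mem_diagram
      using h cs eq1 eq2 by (cases "y = 0") auto
  qed
qed

lemma Vertical_in_path_iff:
  assumes \<alpha>: "is_partition \<alpha>"
  shows "Vertical x y \<in> boundary_path \<alpha> \<longleftrightarrow> x + y \<in> beads \<alpha> \<and> - y = cnt \<alpha> (x + y)"
proof -
  have 1: "Vertical x y \<in> boundary_path \<alpha> \<longleftrightarrow> 1 \<le> - y \<and> 0 \<le> x \<and>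
      (x = 0 \<or> (- y, x) \<in> diagram \<alpha>) \<and> (- y, x + 1) \<notin> diagram \<alpha>"
    unfolding boundary_path_def
    by (rule iffI, fastforce, rule UnI2, rule CollectI, rule exI[of _ "- y"],
        rule exI[of _ x], simp)
  have eq1: "- y \<le> cnt \<alpha> (x + y + 1) \<longleftrightarrow> x + 1 \<le> part \<alpha> (- y)" if "1 \<le> - y"
    using le_cnt_iff[OF \<alpha> that, of "x + y + 1"] by auto
  have eq2: "- y \<le> cnt \<alpha> (x + y) \<longleftrightarrow> x \<le> part \<alpha> (- y)" if "1 \<le> - y"
    using le_cnt_iff[OF \<alpha> that, of "x + y"] by auto
  have cs: "cnt \<alpha> (x + y + 1) = cnt \<alpha> (x + y) - of_bool (x + y \<in> beads \<alpha>)" by (rule cnt_Suc[OF \<alpha>])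
  have 2: "Vertical x y \<in> boundary_path \<alpha> \<longleftrightarrow>
      1 \<le> - y \<and> - y \<le> cnt \<alpha> (x + y) \<and> \<not> - y \<le> cnt \<alpha> (x + y + 1)"
    unfolding 1 mem_diagram using eq1 eq2 part_nonneg[of \<alpha> "- y"] by auto
  show ?thesis unfolding 2 using cs cnt_nonneg[of \<alpha> "x + y + 1"]
    by (auto simp: of_bool_def split: if_splits)
qed

lemma boundary_step_eq:
  assumes \<alpha>: "is_partition \<alpha>"
  shows "boundary_step \<alpha> k =
    (if k \<in> beads \<alpha> then Vertical (k + cnt \<alpha> k) (- cnt \<alpha> k) else Horizontal (k + cnt \<alpha> k) (- cnt \<alpha> k))"
  unfolding boundary_step_def
  by (rule the1_equality[OF boundary_path_ex1[OF \<alpha>]])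
    (auto simp: Horizontal_in_path_iff[OF \<alpha>] Vertical_in_path_iff[OF \<alpha>])

text \<open>Two consecutive diagonals together are the squares of one snake, also when the snake is
  empty because the two paths share the step.\<close>

lemma snake_eq: "snake lam mu k = {s \<in> D. content s = k \<or> content s = k + 1}"
proof -
  let ?m = "cnt lam k"
  have cl: "cnt lam (k + 1) = ?m - of_bool (k \<in> beads lam)" by (rule cnt_Suc[OF part_lam])
  have cm: "cnt mu (k + 1) = cnt mu k - of_bool (k \<in> beads mu)" by (rule cnt_Suc[OF part_mu])
  have Dk: "s \<in> D \<and> content s = k' \<longleftrightarrow> content s = k' \<and> cnt mu k' < fst s \<and> fst s \<le> cnt lam k'" for s k'
    by (cases s) (auto simp: mem_D)
  show ?thesis
  proof (cases "k \<in> beads lam")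
    case True
    then have e: "boundary_step lam k = Vertical (k + ?m) (- ?m)"
      by (simp add: boundary_step_eq[OF part_lam])
    show ?thesis
    proof (cases "Vertical (k + ?m) (- ?m) \<in> boundary_path mu")
      case on: True
      then have "k \<in> beads mu" "cnt mu k = ?m" by (auto simp: Vertical_in_path_iff[OF part_mu])
      \<comment> \<open>A shared step makes the two counts equal at \<open>k\<close> and then also
        at \<open>k + 1\<close>, so both diagonals are empty.\<close>
      then have "\<not> (s \<in> D \<and> content s = k) \<and> \<not> (s \<in> D \<and> content s = k + 1)" for s
        unfolding Dk using cl cm True by auto
      then have "{s \<in> D. content s = k \<or> content s = k + 1} = {}" by blast
      then show ?thesis using e on by (simp add: snake_def)
    next
      case off: False
      have "snake lam mu k = D \<inter> ({(?m - p, (k + ?m) - p) | p. 0 \<le> p} \<union> {(?m - p - 1, k + ?m - p) | p. 0 \<le> p})"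
        using e off by (simp add: snake_def Let_def)
      \<comment> \<open>The zigzag covers the two diagonals down to rows \<open>cnt lam k\<close>
        and \<open>cnt lam (k + 1)\<close>, the lower bounds of \<open>D\<close> there.\<close>
      also have "{(?m - p, (k + ?m) - p) | p. 0 \<le> p} \<union> {(?m - p - 1, k + ?m - p) | p. 0 \<le> p} = {s. content s = k \<and> fst s \<le> ?m \<or> content s = k + 1 \<and> fst s \<le> ?m - 1}"
      proof (rule set_eqI)
        fix s :: square
        show "s \<in> {(?m - p, (k + ?m) - p) | p. 0 \<le> p} \<union> {(?m - p - 1, k + ?m - p) | p. 0 \<le> p} \<longleftrightarrow> s \<in> {s. content s = k \<and> fst s \<le> ?m \<or> content s = k + 1 \<and> fst s \<le> ?m - 1}"
          by (cases s) (auto, presburger+)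
      qed
      also have "D \<inter> \<dots> = {s \<in> D. content s = k \<or> content s = k + 1}"
        using Dk[of _ k] Dk[of _ "k + 1"] cl True by (intro set_eqI) (smt (verit) Int_iff mem_Collect_eq of_bool_eq)
      finally show ?thesis .
    qed
  next
    case False
    then have e: "boundary_step lam k = Horizontal (k + ?m) (- ?m)"
      by (simp add: boundary_step_eq[OF part_lam])
    show ?thesis
    proof (cases "Horizontal (k + ?m) (- ?m) \<in> boundary_path mu")
      case on: True
      then have "k \<notin> beads mu" "cnt mu k = ?m" by (auto simp: Horizontal_in_path_iff[OF part_mu])
      then have "\<not> (s \<in> D \<and> content s = k) \<and> \<not> (s \<in> D \<and> content s = k + 1)" for s
        unfolding Dk using cl cm False by auto
      then have "{s \<in> D. content s = k \<or> content s = k + 1} = {}" by blast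
      then show ?thesis using e on by (simp add: snake_def)
    next
      case off: False
      have "snake lam mu k = D \<inter> ({(?m - p, (k + ?m + 1) - p) | p. 0 \<le> p} \<union> {(?m - p, k + ?m + 1 - p - 1) | p. 0 \<le> p})"
        using e off by (simp add: snake_def Let_def)
      also have "{(?m - p, (k + ?m + 1) - p) | p. 0 \<le> p} \<union> {(?m - p, k + ?m + 1 - p - 1) | p. 0 \<le> p} = {s. content s = k \<and> fst s \<le> ?m \<or> content s = k + 1 \<and> fst s \<le> ?m}"
      proof (rule set_eqI)
        fix s :: square
        show "s \<in> {(?m - p, (k + ?m + 1) - p) | p. 0 \<le> p} \<union> {(?m - p, k + ?m + 1 - p - 1) | p. 0 \<le> p} \<longleftrightarrow> s \<in> {s. content s = k \<and> fst s \<le> ?m \<or> content s = k + 1 \<and> fst s \<le> ?m}"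
          by (cases s) (auto, presburger+)
      qed
      also have "D \<inter> \<dots> = {s \<in> D. content s = k \<or> content s = k + 1}"
        using Dk[of _ k] Dk[of _ "k + 1"] cl False by (intro set_eqI) (smt (verit) Int_iff mem_Collect_eq of_bool_eq)
      finally show ?thesis .
    qed
  qed
qed

lemma snake_length_eq: "snake_length lam mu k = N k + N (k + 1) - 1"
proof -
  have "card (snake lam mu k) = card {s \<in> D. content s = k} + card {s \<in> D. content s = k + 1}"
    unfolding snake_eq
    by (subst card_Un_disjoint[symmetric]) (auto intro: arg_cong[where f = card] simp: finite_D)
  then show ?thesis using card_D_content by (simp add: snake_length_def)
qed

text \<open>The number of squares \<open>N k + N (k + 1)\<close> is odd iff the two diagonals differ
  in size, that is, iff \<open>k\<close> is a bead of just one partition; the direction of the step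
  tells which.\<close>

lemma snake_label_Left: "snake_label lam mu k = Left_Snake \<longleftrightarrow> k \<in> Lset"
  and snake_label_Right: "snake_label lam mu k = Right_Snake \<longleftrightarrow> k \<in> Rset"
proof -
  have "(0 \<le> N k + N (k + 1) - 1 \<and> even (N k + N (k + 1) - 1)) \<longleftrightarrow> k \<in> Lset \<or> k \<in> Rset"
    using N_Suc[of k] N_nonneg[of k] N_nonneg[of "k + 1"]
    by (cases "k \<in> beads lam"; cases "k \<in> beads mu") auto
  then show "snake_label lam mu k = Left_Snake \<longleftrightarrow> k \<in> Lset"
    "snake_label lam mu k = Right_Snake \<longleftrightarrow> k \<in> Rset"
    unfolding snake_label_def snake_length_eq boundary_step_eq[OF part_lam] by auto
qed

end

section \<open>Interval sets\<close>

text \<open>The perfect matchings of \<open>L\<close> with \<open>R\<close> that respect the order.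
  Arbitrary sets are allowed so that an induction can remove a pair.\<close>

definition pairings :: "int set \<Rightarrow> int set \<Rightarrow> (int \<times> int) set set" where
  "pairings L R = {I. I \<subseteq> L \<times> R \<and> (\<forall>(u, v)\<in>I. u < v) \<and> bij_betw fst I L \<and> bij_betw snd I R}"

lemma finite_pairings: "finite L \<Longrightarrow> finite R \<Longrightarrow> finite (pairings L R)"
  by (rule finite_subset[of _ "Pow (L \<times> R)"]) (auto simp: pairings_def)

text \<open>\<open>Lset\<close> and \<open>Rset\<close> have exactly rank many elements, so rank
  many pairs with distinct entries exhaust them. Conversely, a left end never equals a right end
  since the two sets are disjoint.\<close>

lemma (in skew_shape) interval_set_iff: "interval_set lam mu I \<longleftrightarrow> I \<in> pairings Lset Rset"
proof
  assume I: "interval_set lam mu I"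
  then have fin: "finite I" and c: "card I = card Lset"
    and d: "disjoint_family_on (\<lambda>(u, v). {u, v}) I"
    and p: "\<And>u v. (u, v) \<in> I \<Longrightarrow> u < v \<and> u \<in> Lset \<and> v \<in> Rset"
    unfolding interval_set_def rank_eq snake_label_Left snake_label_Right by auto
  have d': "p = q" if "p \<in> I" "q \<in> I" "fst p = fst q \<or> snd p = snd q" for p q
  proof (rule ccontr)
    assume "p \<noteq> q"
    then have "{fst p, snd p} \<inter> {fst q, snd q} = {}"
      using d that(1,2) unfolding disjoint_family_on_def by (auto simp: case_prod_beta)
    then show False using that(3) by auto
  qed
  have "bij_betw fst I Lset" unfolding bij_betw_def
  proof
    show i: "inj_on fst I" by (rule inj_onI) (rule d', auto)
    have "fst ` I \<subseteq> Lset" using p by auto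
    then show "fst ` I = Lset"
      using card_image[OF i] c by (intro card_subset_eq finite_Lset) simp_all
  qed
  moreover have "bij_betw snd I Rset" unfolding bij_betw_def
  proof
    show i: "inj_on snd I" by (rule inj_onI) (rule d', auto)
    have "snd ` I \<subseteq> Rset" using p by auto
    then show "snd ` I = Rset"
      using card_image[OF i] c card_Lset_Rset by (intro card_subset_eq finite_Rset) simp_all
  qed
  ultimately show "I \<in> pairings Lset Rset" using p by (auto simp: pairings_def)
next
  assume "I \<in> pairings Lset Rset"
  then have sub: "I \<subseteq> Lset \<times> Rset" and lt: "\<forall>(u, v)\<in>I. u < v"
    and b1: "bij_betw fst I Lset" and b2: "bij_betw snd I Rset" by (auto simp: pairings_def)
  have "finite I" using bij_betw_finite[OF b1] finite_Lset by simp
  moreover have "disjoint_family_on (\<lambda>(u, v). {u, v}) I"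
    unfolding disjoint_family_on_def
  proof (intro ballI impI)
    fix p q assume pq: "p \<in> I" "q \<in> I" "p \<noteq> q"
    then have "fst p \<noteq> fst q" "snd p \<noteq> snd q"
      using b1 b2 unfolding bij_betw_def inj_on_def by blast+
    moreover have "fst p \<in> Lset" "fst q \<in> Lset" "snd p \<in> Rset" "snd q \<in> Rset"
      using sub pq by (auto simp: mem_Times_iff)
    ultimately show "(case p of (u, v) \<Rightarrow> {u, v}) \<inter> (case q of (u, v) \<Rightarrow> {u, v}) = {}"
      by (auto simp: case_prod_beta)
  qed
  moreover have "\<forall>(u, v)\<in>I. u < v \<and> u \<in> Lset \<and> v \<in> Rset" using lt sub by fast
  ultimately show "interval_set lam mu I"
    unfolding interval_set_def rank_eq snake_label_Left snake_label_Right
    using bij_betw_same_card[OF b1] by simp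
qed

lemma insert_pairings:
  assumes "J \<in> pairings (L - {u}) (R - {v})" "u \<in> L" "v \<in> R" "u < v"
  shows "insert (u, v) J \<in> pairings L R"
proof -
  have J: "J \<subseteq> (L - {u}) \<times> (R - {v})" "\<forall>(u, v)\<in>J. u < v"
    "bij_betw fst J (L - {u})" "bij_betw snd J (R - {v})" using assms(1) by (auto simp: pairings_def)
  have n: "(u, v) \<notin> J" using J(1) by auto
  have "bij_betw fst (insert (u, v) J) L"
    using J(3) n assms(2) notIn_Un_bij_betw[of "(u, v)" J fst "L - {u}"] by (simp add: insert_absorb)
  moreover have "bij_betw snd (insert (u, v) J) R"
    using J(4) n assms(3) notIn_Un_bij_betw[of "(u, v)" J snd "R - {v}"] by (simp add: insert_absorb)
  ultimately show ?thesis using J assms by (auto simp: pairings_def)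
qed

lemma remove_pairings:
  assumes "I \<in> pairings L R" "(u, v) \<in> I"
  shows "I - {(u, v)} \<in> pairings (L - {u}) (R - {v})"
proof -
  have I: "I \<subseteq> L \<times> R" "\<forall>(u, v)\<in>I. u < v" "bij_betw fst I L" "bij_betw snd I R"
    using assms(1) by (auto simp: pairings_def)
  have f: "bij_betw fst (I - {(u, v)}) (L - {u})"
    using bij_betw_DiffI[OF I(3), of "{(u, v)}" "{u}"] I(1) assms(2) by (auto simp: bij_betw_def)
  have s: "bij_betw snd (I - {(u, v)}) (R - {v})"
    using bij_betw_DiffI[OF I(4), of "{(u, v)}" "{v}"] I(1) assms(2) by (auto simp: bij_betw_def)
  have "p \<in> (L - {u}) \<times> (R - {v})" if "p \<in> I - {(u, v)}" for p
    using bij_betwE[OF f] bij_betwE[OF s] that by (auto simp: mem_Times_iff)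
  then show ?thesis using f s I(2) by (auto simp: pairings_def)
qed

text \<open>The smallest right end \<open>v\<close> may be paired with every smaller left end, and doing so lowers
  both counts by one in the factors of the remaining right ends.\<close>

lemma card_pairings:
  assumes "finite L" "finite R" "card L = card R"
  shows "int (card (pairings L R)) =
    (\<Prod>v\<in>R. int (card {u \<in> L. u < v}) - int (card {w \<in> R. w < v}))"
  using assms
proof (induction "card R" arbitrary: L R)
  case 0
  then have "L = {}" "R = {}" by auto
  moreover have "pairings {} {} = {{}}" by (auto simp: pairings_def bij_betw_def)
  ultimately show ?case by simp
next
  case (Suc n)
  define v where "v = Min R"
  define F where "F L R v = int (card {u \<in> L. u < v}) - int (card {w \<in> R. w < v})" for L R and v :: int
  have v: "v \<in> R" "\<And>w. w \<in> R \<Longrightarrow> v \<le> w"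
    using Suc.hyps(2) Suc.prems(2) unfolding v_def by (auto intro!: Min_in)
  let ?U = "{u \<in> L. u < v}"
  have eq: "pairings L R = (\<Union>u\<in>?U. insert (u, v) ` pairings (L - {u}) (R - {v}))"
  proof
    show "(\<Union>u\<in>?U. insert (u, v) ` pairings (L - {u}) (R - {v})) \<subseteq> pairings L R"
      using insert_pairings v(1) by blast
    show "pairings L R \<subseteq> (\<Union>u\<in>?U. insert (u, v) ` pairings (L - {u}) (R - {v}))"
    proof
      fix I assume I: "I \<in> pairings L R"
      then have "v \<in> snd ` I" using v(1) by (auto simp: pairings_def bij_betw_def)
      then obtain u where uv: "(u, v) \<in> I" by force
      then have "u \<in> ?U" using I by (auto simp: pairings_def)
      moreover have "I = insert (u, v) (I - {(u, v)})" using uv by blast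
      ultimately show "I \<in> (\<Union>u\<in>?U. insert (u, v) ` pairings (L - {u}) (R - {v}))"
        using remove_pairings[OF I uv] by blast
    qed
  qed
  have fp: "finite (pairings (L - {u}) (R - {v}))" for u using Suc.prems by (simp add: finite_pairings)
  have "card (pairings L R) = (\<Sum>u\<in>?U. card (insert (u, v) ` pairings (L - {u}) (R - {v})))"
    unfolding eq
  proof (rule card_UN_disjoint)
    show "\<forall>u\<in>?U. \<forall>u'\<in>?U. u \<noteq> u' \<longrightarrow> insert (u, v) ` pairings (L - {u}) (R - {v}) \<inter>
        insert (u', v) ` pairings (L - {u'}) (R - {v}) = {}"
      by (auto simp: pairings_def)
  qed (use Suc.prems fp in auto)
  also have "\<dots> = (\<Sum>u\<in>?U. card (pairings (L - {u}) (R - {v})))"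
  proof (intro sum.cong refl card_image inj_onI)
    fix u I J assume "I \<in> pairings (L - {u}) (R - {v})" "J \<in> pairings (L - {u}) (R - {v})"
      "insert (u, v) I = insert (u, v) J"
    moreover have "(u, v) \<notin> I" "(u, v) \<notin> J" using calculation by (auto simp: pairings_def)
    ultimately show "I = J" by (simp add: insert_ident)
  qed
  also have "int \<dots> = (\<Sum>u\<in>?U. \<Prod>w\<in>R - {v}. F L R w)"
    unfolding of_nat_sum
  proof (rule sum.cong[OF refl])
    fix u assume u: "u \<in> ?U"
    have "int (card (pairings (L - {u}) (R - {v}))) = (\<Prod>w\<in>R - {v}. F (L - {u}) (R - {v}) w)"
      unfolding F_def using Suc.hyps(2) Suc.prems u v by (intro Suc.hyps(1)) auto
    also have "\<dots> = (\<Prod>w\<in>R - {v}. F L R w)"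
    proof (rule prod.cong[OF refl])
      fix w assume w: "w \<in> R - {v}"
      then have vw: "v < w" using v(2)[of w] by auto
      have "{x \<in> L. x < w} = insert u {x \<in> L - {u}. x < w}" "{x \<in> R. x < w} = insert v {x \<in> R - {v}. x < w}"
        using u vw v(1) by auto
      then have "card {x \<in> L. x < w} = Suc (card {x \<in> L - {u}. x < w})"
        "card {x \<in> R. x < w} = Suc (card {x \<in> R - {v}. x < w})"
        using Suc.prems by simp_all
      then show "F (L - {u}) (R - {v}) w = F L R w" unfolding F_def by simp
    qed
    finally show "int (card (pairings (L - {u}) (R - {v}))) = (\<Prod>w\<in>R - {v}. F L R w)" .
  qed
  also have "\<dots> = F L R v * (\<Prod>w\<in>R - {v}. F L R w)"
  proof -
    \<comment> \<open>No right end lies below the smallest one, so its factor counts its possible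
      partners.\<close>
    have "{w \<in> R. w < v} = {}" using v(2) by force
    then have "F L R v = int (card ?U)" unfolding F_def by (simp only: card.empty)
    then show ?thesis by simp
  qed
  also have "\<dots> = (\<Prod>w\<in>R. F L R w)" using prod.remove[OF Suc.prems(2) v(1)] by metis
  finally show ?case unfolding F_def .
qed

text \<open>Negation reverses the order and exchanges left and right ends, so a greedy choice from
  the right becomes one from the left.\<close>

lemma reflect_pairings:
  assumes "I \<in> pairings L R"
  shows "(\<lambda>(u, v). (- v, - u)) ` I \<in> pairings (uminus ` R) (uminus ` L)"
proof -
  have I: "I \<subseteq> L \<times> R" "\<forall>(u, v)\<in>I. u < v" "inj_on fst I" "fst ` I = L" "inj_on snd I" "snd ` I = R"
    using assms by (auto simp: pairings_def bij_betw_def)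
  have "inj_on fst ((\<lambda>(u, v). (- v, - u)) ` I)" "inj_on snd ((\<lambda>(u, v). (- v, - u)) ` I)"
    using I(3,5) unfolding inj_on_def by (clarsimp, metis fst_conv snd_conv prod.inject)+
  moreover have "fst ` (\<lambda>(u, v). (- v, - u)) ` I = uminus ` R" "snd ` (\<lambda>(u, v). (- v, - u)) ` I = uminus ` L"
    unfolding I(4,6)[symmetric] by (auto simp: image_image case_prod_beta)
  ultimately show ?thesis using I(1,2) by (auto simp: pairings_def bij_betw_def)
qed

lemma card_pairings':
  assumes "finite L" "finite R" "card L = card R"
  shows "int (card (pairings L R)) =
    (\<Prod>u\<in>L. int (card {v \<in> R. u < v}) - int (card {w \<in> L. u < w}))"
proof -
  \<comment> \<open>Applied to the reflected sets as well, the inequality gives equality, because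
    double negation returns the original sets.\<close>
  have le: "card (pairings L R) \<le> card (pairings (uminus ` R) (uminus ` L))"
    if "finite L" "finite R" for L R
  proof (rule card_inj_on_le)
    have "inj (\<lambda>(u::int, v::int). (- v, - u))" by (auto intro: injI)
    then show "inj_on ((`) (\<lambda>(u, v). (- v, - u))) (pairings L R)"
      by (auto intro!: inj_onI simp: inj_image_eq_iff)
  qed (use that reflect_pairings finite_pairings in auto)
  have "card (pairings L R) = card (pairings (uminus ` R) (uminus ` L))"
    using le[OF assms(1,2)] le[of "uminus ` R" "uminus ` L"] assms by (simp add: image_image)
  also have "int \<dots> = (\<Prod>x\<in>uminus ` L. int (card {u \<in> uminus ` R. u < x}) - int (card {w \<in> uminus ` L. w < x}))"
    using assms by (intro card_pairings) (auto simp: card_image)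
  also have "\<dots> = (\<Prod>u\<in>L. int (card {v \<in> R. u < v}) - int (card {w \<in> L. u < w}))"
  proof -
    have *: "card {y \<in> uminus ` S. y < - x} = card {y \<in> S. x < y}" for S and x :: int
    proof -
      have "{y \<in> uminus ` S. y < - x} = uminus ` {y \<in> S. x < y}" by auto
      then show ?thesis by (simp add: card_image)
    qed
    show ?thesis by (subst prod.reindex) (auto simp: *)
  qed
  finally show ?thesis .
qed

section \<open>The number of interval sets as two products of diagonal sizes\<close>

context skew_shape
begin

lemma num_interval_sets_eq: "num_interval_sets lam mu = card (pairings Lset Rset)"
  by (simp add: num_interval_sets_def interval_set_iff)

lemma num_interval_sets_eq_prod_Rset: "int (num_interval_sets lam mu) = (\<Prod>v\<in>Rset. N v)"
  unfolding num_interval_sets_eq card_pairings[OF finite_Lset finite_Rset card_Lset_Rset] N_eq_below ..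

text \<open>The factor at \<open>u\<close> counts ends strictly after \<open>u\<close>, that is,
  from \<open>u + 1\<close> on; hence the shifted argument of \<open>N\<close>.\<close>

lemma num_interval_sets_eq_prod_Lset: "int (num_interval_sets lam mu) = (\<Prod>u\<in>Lset. N (u + 1))"
  unfolding num_interval_sets_eq card_pairings'[OF finite_Lset finite_Rset card_Lset_Rset]
  by (simp add: N_eq_above add1_zle_eq)

end

section \<open>Border strips\<close>

text \<open>Strips are traversed from lower left to upper right, so that every step raises the
  content by one.\<close>

definition next_square :: "square \<Rightarrow> square \<Rightarrow> bool" where
  "next_square s t \<longleftrightarrow> t = (fst s, snd s + 1) \<or> t = (fst s - 1, snd s)"

lemma content_next: "next_square s t \<Longrightarrow> content t = content s + 1"
  by (auto simp: next_square_def content_def)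

lemma edge_adjacent_iff: "edge_adjacent s t \<longleftrightarrow> next_square s t \<or> next_square t s"
  by (cases s; cases t) (auto simp: edge_adjacent_def next_square_def abs_if split: if_splits)

lemma skew_convex:
  assumes "is_partition \<alpha>" "is_partition \<beta>" "(i, j) \<in> skew \<alpha> \<beta>" "(i', j') \<in> skew \<alpha> \<beta>"
    "i \<le> a" "a \<le> i'" "j \<le> b" "b \<le> j'"
  shows "(a, b) \<in> skew \<alpha> \<beta>"
  using assms part_antimono[OF assms(1), of a i'] part_antimono[OF assms(2), of i a]
  by (auto simp: skew_def)

text \<open>The squares weakly above and to the left of some square of \<open>B\<close> form the
  outer partition. By convexity, removing \<open>B\<close> leaves a set closed upwards and to the
  left, the inner partition.\<close>

lemma is_skew_diagramI:
  assumes fin: "finite B" and pos: "\<And>i j. (i, j) \<in> B \<Longrightarrow> 1 \<le> i \<and> 1 \<le> j"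
    and conv: "\<And>i j i' j' a b. \<lbrakk>(i, j) \<in> B; (i', j') \<in> B; i \<le> a; a \<le> i'; j \<le> b; b \<le> j'\<rbrakk> \<Longrightarrow> (a, b) \<in> B"
  shows "is_skew_diagram B"
proof -
  define U where "U = {(a, b). 1 \<le> a \<and> 1 \<le> b \<and> (\<exists>(i, j)\<in>B. a \<le> i \<and> b \<le> j)}"
  have "U \<subseteq> (\<Union>(i, j)\<in>B. {1..i} \<times> {1..j})" by (auto simp: U_def)
  then have fU: "finite U" by (rule finite_subset) (use fin in auto)
  have "\<exists>\<alpha>. is_partition \<alpha> \<and> diagram \<alpha> = U"
  proof (rule ex_partition_of_diagram[OF fU])
    fix i j i' j' assume "(i, j) \<in> U" "1 \<le> i'" "i' \<le> i" "1 \<le> j'" "j' \<le> j"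
    moreover from this obtain x y where "(x, y) \<in> B" "i \<le> x" "j \<le> y" by (auto simp: U_def)
    ultimately show "(i', j') \<in> U" unfolding U_def by (auto intro!: bexI[of _ "(x, y)"])
  qed (auto simp: U_def)
  then obtain \<alpha> where \<alpha>: "is_partition \<alpha>" "diagram \<alpha> = U" by blast
  have "\<exists>\<beta>. is_partition \<beta> \<and> diagram \<beta> = U - B"
  proof (rule ex_partition_of_diagram)
    fix i j i' j' assume ij: "(i, j) \<in> U - B" and le: "1 \<le> i'" "i' \<le> i" "1 \<le> j'" "j' \<le> j"
    then obtain x y where xy: "(x, y) \<in> B" "i \<le> x" "j \<le> y" by (auto simp: U_def)
    then have "(i', j') \<in> U" using le unfolding U_def by (auto intro!: bexI[of _ "(x, y)"])
    moreover have "(i', j') \<notin> B" using conv[OF _ xy(1), of i' j' i j] le xy ij by auto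
    ultimately show "(i', j') \<in> U - B" by simp
  qed (use fU in \<open>auto simp: U_def\<close>)
  then obtain \<beta> where \<beta>: "is_partition \<beta>" "diagram \<beta> = U - B" by blast
  have sub: "B \<subseteq> U" using pos by (fastforce simp: U_def)
  have c: "contained \<beta> \<alpha>" unfolding contained_def
  proof (intro allI impI)
    fix i :: int assume i: "1 \<le> i"
    show "part \<beta> i \<le> part \<alpha> i"
    proof (cases "1 \<le> part \<beta> i")
      case True
      then have "(i, part \<beta> i) \<in> diagram \<beta>" using i by (simp add: mem_diagram)
      then have "(i, part \<beta> i) \<in> diagram \<alpha>" unfolding \<beta> \<alpha> by simp
      then show ?thesis by (simp add: mem_diagram)
    qed (use part_nonneg[of \<alpha> i] in linarith)
  qed
  have "skew \<alpha> \<beta> = diagram \<alpha> - diagram \<beta>"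
  proof (rule set_eqI, clarify)
    fix i j show "(i, j) \<in> skew \<alpha> \<beta> \<longleftrightarrow> (i, j) \<in> diagram \<alpha> - diagram \<beta>"
      using part_nonneg[of \<beta> i] by (auto simp: mem_diagram) (auto simp: skew_def)
  qed
  also have "\<dots> = B" using sub unfolding \<alpha> \<beta> by auto
  finally show ?thesis using \<alpha>(1) \<beta>(1) c unfolding is_skew_diagram_def by metis
qed

text \<open>Two squares on one diagonal would, by convexity, force the 2 by 2 block that starts at
  the upper one.\<close>

lemma border_strip_content_inj:
  assumes B: "border_strip B" and "s \<in> B" "t \<in> B" "content s = content t"
  shows "s = t"
proof -
  obtain \<alpha> \<beta> where p: "is_partition \<alpha>" "is_partition \<beta>" "B = skew \<alpha> \<beta>"
    using B by (auto simp: border_strip_def is_skew_diagram_def)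
  have no: "\<not> {(i, j), (i, j + 1), (i + 1, j), (i + 1, j + 1)} \<subseteq> B" for i j
    using B by (auto simp: border_strip_def)
  have *: "\<not> i < i'" if ij: "(i, j) \<in> B" "(i', j') \<in> B" and c: "j - i = j' - i'" for i j i' j'
  proof
    assume "i < i'"
    then have "(a, b) \<in> B" if "a = i \<or> a = i + 1" "b = j \<or> b = j + 1" for a b
      unfolding p(3) using that c
      by (intro skew_convex[OF p(1,2) ij[unfolded p(3)]]) auto
    then show False using no[of i j] by blast
  qed
  obtain i j i' j' where st: "s = (i, j)" "t = (i', j')" by (cases s; cases t)
  show ?thesis using *[of i j i' j'] *[of i' j' i j] assms(2-4) by (auto simp: st)
qed

section \<open>Decompositions as linkages\<close>

text \<open>A decomposition is determined by the pairs of adjacent squares lying in a common strip: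
  each square has at most one successor (to the right or above) and at most one predecessor.\<close>

definition linkages :: "square set \<Rightarrow> (square \<times> square) set set" where
  "linkages D = {E. E \<subseteq> {(s, t). s \<in> D \<and> t \<in> D \<and> next_square s t} \<and> inj_on fst E \<and> inj_on snd E}"

definition links :: "square set set \<Rightarrow> (square \<times> square) set" where
  "links P = {(s, t). next_square s t \<and> (\<exists>B\<in>P. s \<in> B \<and> t \<in> B)}"

abbreviation chain :: "(square \<times> square) set \<Rightarrow> square \<Rightarrow> square set" where
  "chain E s \<equiv> (E \<union> E\<inverse>)\<^sup>* `` {s}"

lemma chain_eq:
  assumes "t \<in> chain E s" shows "chain E t = chain E s"
proof -
  have "(s, t) \<in> (E \<union> E\<inverse>)\<^sup>*" using assms by simp
  moreover have "sym ((E \<union> E\<inverse>)\<^sup>*)" by (rule sym_rtrancl) (auto intro: symI)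
  ultimately have "(t, s) \<in> (E \<union> E\<inverse>)\<^sup>*" by (auto dest: symD)
  then show ?thesis using \<open>(s, t) \<in> (E \<union> E\<inverse>)\<^sup>*\<close> by (auto intro: rtrancl_trans)
qed

lemma linkage_nextD: "E \<in> linkages D \<Longrightarrow> (s, t) \<in> E \<Longrightarrow> s \<in> D \<and> t \<in> D \<and> next_square s t"
  by (auto simp: linkages_def)

lemma linkage_fst_inj: "E \<in> linkages D \<Longrightarrow> (s, t) \<in> E \<Longrightarrow> (s, t') \<in> E \<Longrightarrow> t = t'"
  by (force simp: linkages_def inj_on_def)

lemma linkage_snd_inj: "E \<in> linkages D \<Longrightarrow> (s, t) \<in> E \<Longrightarrow> (s', t) \<in> E \<Longrightarrow> s = s'"
  by (force simp: linkages_def inj_on_def)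

text \<open>Turning around at a square undoes the last step, as predecessors and successors are
  unique; so an undirected walk stays on one directed line.\<close>

lemma chain_linear:
  assumes E: "E \<in> linkages D" and "(s, t) \<in> (E \<union> E\<inverse>)\<^sup>*"
  shows "(s, t) \<in> E\<^sup>* \<or> (t, s) \<in> E\<^sup>*"
  using assms(2)
proof (induction rule: rtrancl_induct)
  case base then show ?case by simp
next
  case (step y z)
  show ?case
  proof (cases "(y, z) \<in> E")
    case True
    then show ?thesis using step.IH linkage_fst_inj[OF E True]
      by (metis converse_rtranclE rtrancl.rtrancl_into_rtrancl rtrancl.rtrancl_refl)
  next
    case False
    then have zy: "(z, y) \<in> E" using step.hyps by simp
    then show ?thesis using step.IH linkage_snd_inj[OF E zy]
      by (metis converse_rtrancl_into_rtrancl rtranclE rtrancl.rtrancl_refl)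
  qed
qed

lemma linkage_mono:
  assumes E: "E \<in> linkages D" and "(s, t) \<in> E\<^sup>*"
  shows "fst t \<le> fst s \<and> snd s \<le> snd t \<and> content s \<le> content t"
  using assms(2)
proof (induction rule: rtrancl_induct)
  case (step y z)
  then show ?case using linkage_nextD[OF E step.hyps(2)]
    by (auto simp: next_square_def content_def)
qed simp

lemma linkage_content_eq:
  assumes E: "E \<in> linkages D" and "(s, t) \<in> E\<^sup>*" "content s = content t"
  shows "s = t"
  using linkage_mono[OF E assms(2)] assms(3) by (auto simp: content_def prod_eq_iff)

lemma chain_content_inj:
  assumes E: "E \<in> linkages D" and "(s, t) \<in> (E \<union> E\<inverse>)\<^sup>*" "content s = content t"
  shows "s = t"
  using chain_linear[OF E assms(2)] linkage_content_eq[OF E] assms(3) by metis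

lemma linkage_between:
  assumes E: "E \<in> linkages D" and "(s, t) \<in> E\<^sup>*" "content s \<le> c" "c \<le> content t"
  shows "\<exists>x. (s, x) \<in> E\<^sup>* \<and> (x, t) \<in> E\<^sup>* \<and> content x = c"
  using assms(2-4)
proof (induction rule: rtrancl_induct)
  case base then show ?case by (intro exI[of _ s]) simp
next
  case (step y z)
  have cz: "content z = content y + 1" using content_next linkage_nextD[OF E step.hyps(2)] by blast
  show ?case
  proof (cases "c \<le> content y")
    case True then show ?thesis using step by (meson rtrancl.rtrancl_into_rtrancl)
  next
    case False
    then have "content z = c" using cz step.prems by simp
    moreover have "(s, z) \<in> E\<^sup>*" using step.hyps by (rule rtrancl.rtrancl_into_rtrancl)
    ultimately show ?thesis by blast
  qed
qed

section \<open>The bijection between border strip decompositions and linkages\<close>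

context skew_shape
begin

lemma D_pos: "(i, j) \<in> D \<Longrightarrow> 1 \<le> i \<and> 1 \<le> j"
  using part_nonneg[of mu i] by (auto simp: skew_def)

lemma chain_subset:
  assumes E: "E \<in> linkages D" and s: "s \<in> D"
  shows "chain E s \<subseteq> D"
proof
  fix t assume "t \<in> chain E s"
  then have "(s, t) \<in> (E \<union> E\<inverse>)\<^sup>*" by simp
  then show "t \<in> D" using s linkage_nextD[OF E] by (induction rule: rtrancl_induct) auto
qed

text \<open>A chain goes only right and up. Two of its squares, one weakly above and to the left of
  the other, therefore share a row or a column and enclose only squares of the chain; this gives
  convexity. Contents on a chain are distinct, which rules out a 2 by 2 block.\<close>

lemma border_strip_chain:
  assumes E: "E \<in> linkages D" and s: "s \<in> D"
  shows "border_strip (chain E s)"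
proof -
  let ?B = "chain E s"
  have sub: "?B \<subseteq> D" by (rule chain_subset[OF assms])
  have conn: "(x, y) \<in> (E \<union> E\<inverse>)\<^sup>*" if "x \<in> ?B" "y \<in> ?B" for x y
    using chain_eq[OF that(1)] that(2) by auto
  have path: "(a, b) \<in> ?B"
    if xy: "(i, j) \<in> ?B" "(i', j') \<in> ?B" "((i, j), (i', j')) \<in> E\<^sup>*" "i \<le> a" "a \<le> i'" "j \<le> b" "b \<le> j'"
    for i j i' j' a b
  proof -
    have "i' = i" using linkage_mono[OF E xy(3)] xy by auto
    then have a: "a = i" using xy by simp
    obtain x where x: "((i, j), x) \<in> E\<^sup>*" "(x, (i', j')) \<in> E\<^sup>*" "content x = b - a"
      using linkage_between[OF E xy(3), of "b - a"] xy a \<open>i' = i\<close> by auto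
    have "x = (a, b)" using linkage_mono[OF E x(1)] linkage_mono[OF E x(2)] x(3) a \<open>i' = i\<close>
      by (cases x) (auto simp: content_def)
    then have "((i, j), (a, b)) \<in> (E \<union> E\<inverse>)\<^sup>*" using x(1) by (meson in_rtrancl_UnI)
    then show ?thesis using xy(1) by (auto intro: rtrancl_trans)
  qed
  have path': "(a, b) \<in> ?B"
    if xy: "(i, j) \<in> ?B" "(i', j') \<in> ?B" "((i', j'), (i, j)) \<in> E\<^sup>*" "i \<le> a" "a \<le> i'" "j \<le> b" "b \<le> j'"
    for i j i' j' a b
  proof -
    have "j' = j" using linkage_mono[OF E xy(3)] xy by auto
    then have b: "b = j" using xy by simp
    obtain x where x: "((i', j'), x) \<in> E\<^sup>*" "(x, (i, j)) \<in> E\<^sup>*" "content x = b - a"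
      using linkage_between[OF E xy(3), of "b - a"] xy b \<open>j' = j\<close> by auto
    have "x = (a, b)" using linkage_mono[OF E x(1)] linkage_mono[OF E x(2)] x(3) b \<open>j' = j\<close>
      by (cases x) (auto simp: content_def)
    then have "((i', j'), (a, b)) \<in> (E \<union> E\<inverse>)\<^sup>*" using x(1) by (meson in_rtrancl_UnI)
    then show ?thesis using xy(2) by (auto intro: rtrancl_trans)
  qed
  have "is_skew_diagram ?B"
  proof (rule is_skew_diagramI)
    show "finite ?B" using sub finite_D by (rule finite_subset)
    show "1 \<le> i \<and> 1 \<le> j" if "(i, j) \<in> ?B" for i j using that sub D_pos by blast
    fix i j i' j' a b assume "(i, j) \<in> ?B" "(i', j') \<in> ?B" "i \<le> a" "a \<le> i'" "j \<le> b" "b \<le> j'"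
    then show "(a, b) \<in> ?B" using path path' chain_linear[OF E conn] by meson
  qed
  moreover have "edge_connected ?B" unfolding edge_connected_def
  proof (intro ballI)
    fix x y assume x: "x \<in> ?B" and "y \<in> ?B"
    then have "(x, y) \<in> (E \<union> E\<inverse>)\<^sup>*" using conn by blast
    then show "(x, y) \<in> {(a, b). a \<in> ?B \<and> b \<in> ?B \<and> edge_adjacent a b}\<^sup>*"
    proof (induction rule: rtrancl_induct)
      case (step y z)
      have "(s, y) \<in> (E \<union> E\<inverse>)\<^sup>*" using x step.hyps(1) by (auto intro: rtrancl_trans)
      moreover from this have "(s, z) \<in> (E \<union> E\<inverse>)\<^sup>*"
        using step.hyps(2) by (rule rtrancl.rtrancl_into_rtrancl)
      moreover have "edge_adjacent y z"
        using step.hyps(2) linkage_nextD[OF E, of y z] linkage_nextD[OF E, of z y]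
        by (auto simp: edge_adjacent_iff)
      ultimately have "(y, z) \<in> {(a, b). a \<in> ?B \<and> b \<in> ?B \<and> edge_adjacent a b}" by simp
      with step.IH show ?case by (rule rtrancl.rtrancl_into_rtrancl)
    qed simp
  qed
  moreover have "\<not> {(i, j), (i, j + 1), (i + 1, j), (i + 1, j + 1)} \<subseteq> ?B" for i j
  proof
    assume "{(i, j), (i, j + 1), (i + 1, j), (i + 1, j + 1)} \<subseteq> ?B"
    then have "(i, j) \<in> ?B" "(i + 1, j + 1) \<in> ?B" by auto
    from chain_content_inj[OF E conn[OF this]] show False by simp
  qed
  moreover have "?B \<noteq> {}" by auto
  ultimately show ?thesis unfolding border_strip_def by blast
qed

lemma bs_decomposition_chains:
  assumes E: "E \<in> linkages D"
  shows "bs_decomposition lam mu (chain E ` D)"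
  unfolding bs_decomposition_def
proof
  show "\<forall>B\<in>chain E ` D. border_strip B" using border_strip_chain[OF E] by blast
  show "partition_on D (chain E ` D)"
  proof (rule partition_onI)
    show "\<Union> (chain E ` D) = D" using chain_subset[OF E] by blast
    fix p q assume "p \<in> chain E ` D" "q \<in> chain E ` D" "p \<noteq> q"
    then show "disjnt p q" unfolding disjnt_def using chain_eq by blast
  qed auto
qed

text \<open>Adjacent squares in one chain differ by one in content, so the directed path between
  them is a single link.\<close>

lemma links_chains:
  assumes E: "E \<in> linkages D"
  shows "links (chain E ` D) = E"
proof (rule set_eqI, clarify)
  fix s t
  show "(s, t) \<in> links (chain E ` D) \<longleftrightarrow> (s, t) \<in> E"
  proof
    assume st: "(s, t) \<in> E"
    then have "t \<in> chain E s" by auto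
    then show "(s, t) \<in> links (chain E ` D)"
      using linkage_nextD[OF E st] by (auto simp: links_def intro!: bexI[of _ s])
  next
    assume "(s, t) \<in> links (chain E ` D)"
    then obtain x where x: "next_square s t" "s \<in> chain E x" "t \<in> chain E x" by (auto simp: links_def)
    have "(s, t) \<in> (E \<union> E\<inverse>)\<^sup>*" using chain_eq[OF x(2)] x(3) by auto
    then have st: "(s, t) \<in> E\<^sup>*"
      using chain_linear[OF E, of s t] linkage_mono[OF E, of t s] content_next[OF x(1)] by auto
    then obtain y where y: "(s, y) \<in> E" "(y, t) \<in> E\<^sup>*"
      using content_next[OF x(1)] by (metis converse_rtranclE add_cancel_left_right zero_neq_one)
    then have "y = t" using linkage_content_eq[OF E y(2)] content_next[OF x(1)] content_next
        linkage_nextD[OF E y(1)] by metis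
    then show "(s, t) \<in> E" using y by simp
  qed
qed

text \<open>A border strip has at most one square of each content, so successor and predecessor of a
  square within its strip are unique.\<close>

lemma links_linkage:
  assumes P: "bs_decomposition lam mu P"
  shows "links P \<in> linkages D"
proof -
  have part: "\<Union>P = D" "disjoint P" "\<And>B. B \<in> P \<Longrightarrow> border_strip B"
    using P by (auto simp: bs_decomposition_def partition_on_def)
  have uniq: "B = B'" if "B \<in> P" "B' \<in> P" "x \<in> B" "x \<in> B'" for B B' x
    using part(2) that by (meson disjnt_iff pairwiseD)
  have "t = t'" if "(s, t) \<in> links P" "(s, t') \<in> links P" for s t t'
  proof -
    obtain B B' where B: "B \<in> P" "s \<in> B" "t \<in> B" "B' \<in> P" "s \<in> B'" "t' \<in> B'"
      "next_square s t" "next_square s t'" using \<open>(s, t) \<in> links P\<close> \<open>(s, t') \<in> links P\<close>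
      by (auto simp: links_def)
    then have "B = B'" using uniq by blast
    then show ?thesis using B border_strip_content_inj[OF part(3), of B t t'] content_next by metis
  qed
  then have f: "inj_on fst (links P)" by (auto simp: inj_on_def)
  have "s = s'" if "(s, t) \<in> links P" "(s', t) \<in> links P" for s s' t
  proof -
    obtain B B' where B: "B \<in> P" "s \<in> B" "t \<in> B" "B' \<in> P" "s' \<in> B'" "t \<in> B'"
      "next_square s t" "next_square s' t" using \<open>(s, t) \<in> links P\<close> \<open>(s', t) \<in> links P\<close>
      by (auto simp: links_def)
    then have "B = B'" using uniq by blast
    then show ?thesis using B border_strip_content_inj[OF part(3), of B s s'] content_next
      by (metis add_right_cancel)
  qed
  then have s: "inj_on snd (links P)" by (auto simp: inj_on_def)
  have "links P \<subseteq> {(s, t). s \<in> D \<and> t \<in> D \<and> next_square s t}" using part(1) by (auto simp: links_def)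
  then show ?thesis using f s by (simp add: linkages_def)
qed

text \<open>Adjacent squares of a strip are linked in one direction or the other, so
  edge-connectedness makes the strip a single chain; links never leave a strip.\<close>

lemma chains_links:
  assumes P: "bs_decomposition lam mu P"
  shows "chain (links P) ` D = P"
proof -
  have part: "\<Union>P = D" "disjoint P" "\<And>B. B \<in> P \<Longrightarrow> border_strip B"
    using P by (auto simp: bs_decomposition_def partition_on_def)
  have uniq: "B = B'" if "B \<in> P" "B' \<in> P" "x \<in> B" "x \<in> B'" for B B' x
    using part(2) that by (meson disjnt_iff pairwiseD)
  have *: "chain (links P) s = B" if B: "B \<in> P" "s \<in> B" for B s
  proof
    show "chain (links P) s \<subseteq> B"
    proof
      fix t assume "t \<in> chain (links P) s"
      then have "(s, t) \<in> (links P \<union> (links P)\<inverse>)\<^sup>*" by simp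
      then show "t \<in> B"
      proof (induction rule: rtrancl_induct)
        case (step y z)
        then obtain B' where "B' \<in> P" "y \<in> B'" "z \<in> B'" by (auto simp: links_def)
        then show ?case using uniq[OF B(1), of B' y] step.IH by blast
      qed (rule B)
    qed
    have "{(a, b). a \<in> B \<and> b \<in> B \<and> edge_adjacent a b} \<subseteq> links P \<union> (links P)\<inverse>"
      using B(1) by (auto simp: links_def edge_adjacent_iff)
    then have "{(a, b). a \<in> B \<and> b \<in> B \<and> edge_adjacent a b}\<^sup>* \<subseteq> (links P \<union> (links P)\<inverse>)\<^sup>*"
      by (rule rtrancl_mono)
    moreover have "(s, t) \<in> {(a, b). a \<in> B \<and> b \<in> B \<and> edge_adjacent a b}\<^sup>*" if "t \<in> B" for t
      using part(3)[OF B(1)] B(2) that unfolding border_strip_def edge_connected_def by blast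
    ultimately show "B \<subseteq> chain (links P) s" by blast
  qed
  show ?thesis
  proof
    show "chain (links P) ` D \<subseteq> P"
    proof clarify
      fix i j assume "(i, j) \<in> D"
      then obtain B where "B \<in> P" "(i, j) \<in> B" using part(1) by blast
      then show "chain (links P) (i, j) \<in> P" using * by metis
    qed
    show "P \<subseteq> chain (links P) ` D"
    proof
      fix B assume B: "B \<in> P"
      then obtain s where s: "s \<in> B" using part(3)[OF B] by (auto simp: border_strip_def)
      then have "s \<in> D" using part(1) B by blast
      then show "B \<in> chain (links P) ` D" using *[OF B s] by blast
    qed
  qed
qed

lemma finite_linkage: "E \<in> linkages D \<Longrightarrow> finite E"
  by (rule finite_subset[of _ "D \<times> D"]) (auto simp: linkages_def finite_D)

text \<open>Each strip contains exactly one square that is not linked to a successor.\<close>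

lemma card_chains:
  assumes E: "E \<in> linkages D"
  shows "card (chain E ` D) + card E = card D"
proof -
  have "bij_betw (chain E) (D - Domain E) (chain E ` D)"
    unfolding bij_betw_def
  proof
    show "inj_on (chain E) (D - Domain E)"
    proof (rule inj_onI)
      fix s t assume st: "s \<in> D - Domain E" "t \<in> D - Domain E" "chain E s = chain E t"
      then have "(s, t) \<in> (E \<union> E\<inverse>)\<^sup>*" by auto
      then consider "(s, t) \<in> E\<^sup>*" | "(t, s) \<in> E\<^sup>*" using chain_linear[OF E] by blast
      then show "s = t"
      proof cases
        case 1 then show ?thesis using st(1) by (cases rule: converse_rtranclE) auto
      next
        case 2 then show ?thesis using st(2) by (cases rule: converse_rtranclE) auto
      qed
    qed
    have "\<exists>t\<in>D - Domain E. chain E s = chain E t" if s: "s \<in> D" for s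
    proof -
      have fin: "finite (content ` chain E s)" using finite_subset[OF chain_subset[OF E s] finite_D] by blast
      \<comment> \<open>A square of largest content in the chain cannot have a successor.\<close>
      have "Max (content ` chain E s) \<in> content ` chain E s" using fin by (intro Max_in) auto
      then obtain t where t: "t \<in> chain E s" "content t = Max (content ` chain E s)" by force
      have "t \<notin> Domain E"
      proof
        assume "t \<in> Domain E"
        then obtain x where x: "(t, x) \<in> E" by blast
        then have "x \<in> chain E s" using t(1)
          by (metis Image_singleton_iff UnI1 rtrancl.rtrancl_into_rtrancl)
        then have "content x \<le> content t" using t(2) fin by auto
        then show False using content_next linkage_nextD[OF E x] by fastforce
      qed
      then show ?thesis using t(1) chain_subset[OF E s] chain_eq[OF t(1)] by blast
    qed
    then show "chain E ` (D - Domain E) = chain E ` D" by blast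
  qed
  then have "card (chain E ` D) = card (D - Domain E)" by (rule bij_betw_same_card[symmetric])
  also have "\<dots> = card D - card (Domain E)"
    using E finite_linkage[OF E] by (intro card_Diff_subset finite_Domain) (auto simp: linkages_def)
  also have "card (Domain E) = card E"
    unfolding Domain_fst using E by (intro card_image) (simp add: linkages_def)
  finally have "card (chain E ` D) = card D - card E" .
  moreover have "Domain E \<subseteq> D" using E by (auto simp: linkages_def)
  moreover have "card E \<le> card D"
    using card_mono[OF finite_D \<open>Domain E \<subseteq> D\<close>] \<open>card (Domain E) = card E\<close> by simp
  ultimately show ?thesis by simp
qed

end

section \<open>Links between consecutive diagonals\<close>

text \<open>The links between consecutive diagonals with rows \<open>a < i \<le> b\<close> and
  \<open>a' < i' \<le> b'\<close>. A link to the right keeps the row number and a link upwards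
  lowers it by one, so the rows alone record it.\<close>

definition row_links :: "int \<Rightarrow> int \<Rightarrow> int \<Rightarrow> int \<Rightarrow> (int \<times> int) set set" where
  "row_links a b a' b' = {G. G \<subseteq> {(i, i'). a < i \<and> i \<le> b \<and> a' < i' \<and> i' \<le> b' \<and> (i' = i \<or> i' = i - 1)} \<and>
     inj_on fst G \<and> inj_on snd G}"

text \<open>Rows up to \<open>m\<close> are linked upwards, the others to the right. For
  \<open>m\<close> in \<open>{a..b}\<close>, row \<open>m\<close> is the only one of the rows
  \<open>a\<close> to \<open>b\<close> of the second diagonal that stays unlinked.\<close>

definition threshold :: "int \<Rightarrow> int \<Rightarrow> int \<Rightarrow> (int \<times> int) set" where
  "threshold a b m = (\<lambda>i. (i, if i \<le> m then i - 1 else i)) ` {a<..b}"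

lemma finite_row_link: "G \<in> row_links a b a' b' \<Longrightarrow> finite G"
  by (rule finite_subset[of _ "{a<..b} \<times> {a'<..b'}"]) (auto simp: row_links_def)

lemma card_row_link_le:
  assumes "G \<in> row_links a b a' b'"
  shows "card G \<le> nat (b - a)" "card G \<le> nat (b' - a')"
proof -
  have "fst ` G \<subseteq> {a<..b}" "snd ` G \<subseteq> {a'<..b'}" using assms by (auto simp: row_links_def)
  then have "card (fst ` G) \<le> card {a<..b}" "card (snd ` G) \<le> card {a'<..b'}"
    by (auto intro!: card_mono simp del: card_greaterThanAtMost_int)
  then show "card G \<le> nat (b - a)" "card G \<le> nat (b' - a')"
    using assms by (auto simp: row_links_def card_image)
qed

lemma card_threshold: "card (threshold a b m) = nat (b - a)"
  unfolding threshold_def by (subst card_image) (auto simp: inj_on_def)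

text \<open>If row \<open>i\<close> is linked upwards, it takes row \<open>i - 1\<close> of the
  second diagonal, so row \<open>i - 1\<close> of the first cannot be linked to the right and goes
  upwards too. The upward rows are thus an initial segment.\<close>

lemma full_row_link_eq_threshold:
  assumes G: "G \<in> row_links a b a' b'" and c: "card G = nat (b - a)" and ab: "a \<le> b"
  shows "\<exists>m\<in>{a..b}. G = threshold a b m"
proof -
  have inj: "inj_on fst G" "inj_on snd G" and fin: "finite G"
    and r: "\<And>i i'. (i, i') \<in> G \<Longrightarrow> a < i \<and> i \<le> b \<and> (i' = i \<or> i' = i - 1)"
    using G finite_row_link[OF G] by (auto simp: row_links_def)
  have "fst ` G = {a<..b}"
  proof (rule card_subset_eq)
    show "fst ` G \<subseteq> {a<..b}" using r by force
    show "card (fst ` G) = card {a<..b}" using card_image[OF inj(1)] c by simp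
  qed simp
  then have ex: "(i, i) \<in> G \<or> (i, i - 1) \<in> G" if "a < i" "i \<le> b" for i
  proof -
    have "i \<in> fst ` G" using that \<open>fst ` G = {a<..b}\<close> by simp
    then show ?thesis using r by force
  qed
  have single: "x = y" if "(i, x) \<in> G" "(i, y) \<in> G" for i x y using inj(1) that by (force simp: inj_on_def)
  have single': "x = y" if "(x, i) \<in> G" "(y, i) \<in> G" for i x y using inj(2) that by (force simp: inj_on_def)
  \<comment> \<open>The value \<open>a\<close>, which is not a row here, stands for the case that no
    row is linked upwards.\<close>
  define M where "M = insert a {i. (i, i - 1) \<in> G}"
  have "M \<subseteq> {a..b}" using r ab by (fastforce simp: M_def)
  then have fM: "finite M" by (rule finite_subset) simp
  define m where "m = Max M"
  have mM: "m \<in> M" unfolding m_def using fM by (intro Max_in) (auto simp: M_def)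
  have mab: "m \<in> {a..b}" using mM \<open>M \<subseteq> {a..b}\<close> by blast
  have above: "(i, i) \<in> G" if "m < i" "i \<le> b" for i
  proof -
    have "i \<notin> M" using Max_ge[OF fM, of i] that by (auto simp: m_def)
    then show ?thesis using ex[of i] that mab by (auto simp: M_def)
  qed
  have below: "a < i \<longrightarrow> (i, i - 1) \<in> G" if "i \<le> m" for i
    using that
  proof (induction i rule: int_le_induct)
    case base then show ?case using mM by (auto simp: M_def)
  next
    case (step i)
    show ?case
    proof
      assume a: "a < i - 1"
      then have "(i, i - 1) \<in> G" using step by simp
      then have "(i - 1, i - 1) \<notin> G" using single'[of i "i - 1" "i - 1"] by auto
      then show "(i - 1, i - 1 - 1) \<in> G" using ex[of "i - 1"] a step mab by auto
    qed
  qed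
  have "G = threshold a b m"
  proof (rule set_eqI, clarify)
    fix i x
    show "(i, x) \<in> G \<longleftrightarrow> (i, x) \<in> threshold a b m"
    proof
      assume g: "(i, x) \<in> G"
      then have "a < i" "i \<le> b" using r by auto
      then show "(i, x) \<in> threshold a b m"
        using single[OF g, of i] single[OF g, of "i - 1"] above[of i] below[of i]
        by (cases "i \<le> m") (auto simp: threshold_def image_iff)
    next
      assume "(i, x) \<in> threshold a b m"
      then show "(i, x) \<in> G" using above[of i] below[of i] by (auto simp: threshold_def split: if_splits)
    qed
  qed
  then show ?thesis using mab by blast
qed

lemma threshold_inject:
  assumes "threshold a b m = threshold a b m'" "m \<in> {a..b}" "m' \<in> {a..b}"
  shows "m = m'"
proof (rule ccontr)
  assume "m \<noteq> m'"
  define i where "i = max m m'"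
  have i: "i \<in> {a<..b}" using assms(2,3) \<open>m \<noteq> m'\<close> by (auto simp: i_def)
  have "(i, if i \<le> m then i - 1 else i) \<in> threshold a b m"
    unfolding threshold_def by (rule image_eqI[OF refl i])
  then have "(i, if i \<le> m then i - 1 else i) \<in> threshold a b m'" using assms(1) by blast
  then show False using \<open>m \<noteq> m'\<close> by (auto simp: threshold_def i_def split: if_splits)
qed

text \<open>The odd snake: any of the \<open>b - a + 1\<close> squares of the longer diagonal can be
  the one left out.\<close>

lemma row_links_extra:
  assumes "a \<le> b"
  shows "card {G \<in> row_links a b (a - 1) b. card G = nat (b - a)} = nat (b - a + 1)"
proof -
  have "{G \<in> row_links a b (a - 1) b. card G = nat (b - a)} = threshold a b ` {a..b}"
  proof
    show "{G \<in> row_links a b (a - 1) b. card G = nat (b - a)} \<subseteq> threshold a b ` {a..b}"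
      using full_row_link_eq_threshold assms by blast
    show "threshold a b ` {a..b} \<subseteq> {G \<in> row_links a b (a - 1) b. card G = nat (b - a)}"
      by (auto simp: card_threshold row_links_def) (auto simp: threshold_def inj_on_def split: if_splits)
  qed
  moreover have "inj_on (threshold a b) {a..b}" using threshold_inject by (rule inj_onI)
  ultimately show ?thesis by (simp add: card_image)
qed

text \<open>The even snake: row \<open>a\<close> is missing from the second diagonal, so row
  \<open>a + 1\<close> cannot be linked upwards and the threshold is forced to be
  \<open>a\<close>.\<close>

lemma row_links_equal:
  assumes "a \<le> b"
  shows "card {G \<in> row_links a b a b. card G = nat (b - a)} = 1"
proof -
  have "{G \<in> row_links a b a b. card G = nat (b - a)} = {threshold a b a}"
  proof
    show "{threshold a b a} \<subseteq> {G \<in> row_links a b a b. card G = nat (b - a)}"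
      by (auto simp: card_threshold row_links_def) (auto simp: threshold_def inj_on_def)
    show "{G \<in> row_links a b a b. card G = nat (b - a)} \<subseteq> {threshold a b a}"
    proof clarify
      fix G assume G: "G \<in> row_links a b a b" "card G = nat (b - a)"
      then obtain m where m: "m \<in> {a..b}" "G = threshold a b m"
        using full_row_link_eq_threshold[OF G assms] by blast
      have "m = a"
      proof (rule ccontr)
        assume "m \<noteq> a"
        then have "(a + 1, a) \<in> G" using m by (auto simp: threshold_def image_iff)
        then show False using G(1) by (auto simp: row_links_def)
      qed
      then show "G = threshold a b a" using m by simp
    qed
  qed
  then show ?thesis by simp
qed

text \<open>Reversing the links and shifting one side turns steps \<open>i \<mapsto> i, i - 1\<close> into steps of the same kind.\<close>

lemma row_links_flip:
  "card {G \<in> row_links a b a' b'. card G = n} = card {G \<in> row_links (a' + 1) (b' + 1) a b. card G = n}"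
proof (rule bij_betw_same_card)
  define f where "f = (\<lambda>(i::int, i'::int). (i' + 1, i))"
  define g where "g = (\<lambda>(x::int, y::int). (y, x - 1))"
  have fg: "f (g p) = p" "g (f p) = p" for p by (auto simp: f_def g_def split: prod.splits)
  have "inj f" "inj g" using fg by (metis injI)+
  then have card: "card (f ` G) = card G" "card (g ` G) = card G" for G
    by (metis card_image inj_on_subset subset_UNIV)+
  have f: "f ` G \<in> row_links (a' + 1) (b' + 1) a b" if "G \<in> row_links a b a' b'" for G
  proof -
    have i: "inj_on fst G" "inj_on snd G" and r: "\<And>i i'. (i, i') \<in> G \<Longrightarrow>
        a < i \<and> i \<le> b \<and> a' < i' \<and> i' \<le> b' \<and> (i' = i \<or> i' = i - 1)"
      using that by (auto simp: row_links_def)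
    have "fst (f p) = snd p + 1" "snd (f p) = fst p" for p by (auto simp: f_def case_prod_beta)
    then have "inj_on fst (f ` G)" "inj_on snd (f ` G)" using i by (auto simp: inj_on_def)
    moreover have "f ` G \<subseteq> {(i, i'). a' + 1 < i \<and> i \<le> b' + 1 \<and> a < i' \<and> i' \<le> b \<and> (i' = i \<or> i' = i - 1)}"
      using r by (force simp: f_def)
    ultimately show ?thesis by (simp add: row_links_def)
  qed
  have g: "g ` G \<in> row_links a b a' b'" if "G \<in> row_links (a' + 1) (b' + 1) a b" for G
  proof -
    have i: "inj_on fst G" "inj_on snd G" and r: "\<And>i i'. (i, i') \<in> G \<Longrightarrow>
        a' + 1 < i \<and> i \<le> b' + 1 \<and> a < i' \<and> i' \<le> b \<and> (i' = i \<or> i' = i - 1)"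
      using that by (auto simp: row_links_def)
    have "fst (g p) = snd p" "snd (g p) = fst p - 1" for p by (auto simp: g_def case_prod_beta)
    then have "inj_on fst (g ` G)" "inj_on snd (g ` G)" using i by (auto simp: inj_on_def)
    moreover have "g ` G \<subseteq> {(i, i'). a < i \<and> i \<le> b \<and> a' < i' \<and> i' \<le> b' \<and> (i' = i \<or> i' = i - 1)}"
      using r by (force simp: g_def)
    ultimately show ?thesis by (simp add: row_links_def)
  qed
  show "bij_betw ((`) f) {G \<in> row_links a b a' b'. card G = n}
      {G \<in> row_links (a' + 1) (b' + 1) a b. card G = n}"
    by (rule bij_betw_byWitness[where f' = "(`) g"]) (use f g card in \<open>auto simp: image_image fg\<close>)
qed

section \<open>Minimal border strip decompositions\<close>

context skew_shape
begin

abbreviation links_at :: "int \<Rightarrow> (int \<times> int) set set" where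
  "links_at k \<equiv> row_links (cnt mu k) (cnt lam k) (cnt mu (k + 1)) (cnt lam (k + 1))"

definition max_links :: "int \<Rightarrow> nat" where
  "max_links k = nat (min (N k) (N (k + 1)))"

lemma card_links_at_le: "G \<in> links_at k \<Longrightarrow> card G \<le> max_links k"
  using card_row_link_le[of G] by (force simp: max_links_def N_def)

text \<open>If \<open>k\<close> is a bead of \<open>lam\<close>, the second diagonal ends one row
  earlier than the first, and flipping restores one of the two standard shapes. Writing 1 away from
  \<open>Lset\<close> and \<open>Rset\<close> lets the product over all \<open>k\<close>
  split.\<close>

lemma card_max_links_at:
  "int (card {G \<in> links_at k. card G = max_links k}) =
    (if k \<in> Lset then N (k + 1) else 1) * (if k \<in> Rset then N k else 1)"
proof -
  have le: "cnt mu k \<le> cnt lam k" "cnt mu (k + 1) \<le> cnt lam (k + 1)"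
    using N_nonneg[of k] N_nonneg[of "k + 1"] by (auto simp: N_def)
  have c: "cnt lam (k + 1) = cnt lam k - of_bool (k \<in> beads lam)"
    "cnt mu (k + 1) = cnt mu k - of_bool (k \<in> beads mu)"
    by (rule cnt_Suc[OF part_lam], rule cnt_Suc[OF part_mu])
  note flip = row_links_flip[of "cnt mu k" "cnt lam k" "cnt mu (k + 1)" "cnt lam (k + 1)"]
  show ?thesis
  proof (cases "k \<in> beads lam"; cases "k \<in> beads mu")
    assume "k \<in> beads lam" "k \<in> beads mu"
    then show ?thesis using row_links_equal[OF le(1)] c flip by (simp add: max_links_def N_def)
  next
    assume *: "k \<in> beads lam" "k \<notin> beads mu"
    then have "cnt mu k + 1 \<le> cnt lam k" using le c by simp
    moreover have "max_links k = nat (cnt lam k - (cnt mu k + 1))"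
      using c * by (simp add: max_links_def N_def)
    ultimately have "card {G \<in> links_at k. card G = max_links k} = nat (cnt lam k - cnt mu k)"
      unfolding flip using row_links_extra[of "cnt mu k + 1" "cnt lam k"] c * by simp
    then show ?thesis using * le by (simp add: N_def)
  next
    assume *: "k \<notin> beads lam" "k \<in> beads mu"
    moreover have "max_links k = nat (cnt lam k - cnt mu k)"
      using c * by (simp add: max_links_def N_def)
    ultimately have "card {G \<in> links_at k. card G = max_links k} = nat (cnt lam k - cnt mu k + 1)"
      using row_links_extra[OF le(1)] c by simp
    then show ?thesis using * c le by (simp add: N_def)
  next
    assume "k \<notin> beads lam" "k \<notin> beads mu"
    then show ?thesis using row_links_equal[OF le(1)] c by (simp add: max_links_def N_def)
  qed
qed

section \<open>Splitting a linkage into its snakes\<close>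

definition rows :: "(square \<times> square) set \<Rightarrow> int \<Rightarrow> (int \<times> int) set" where
  "rows E k = {(i, i'). ((i, i + k), (i', i' + (k + 1))) \<in> E}"

definition squares_of_rows :: "(int \<Rightarrow> (int \<times> int) set) \<Rightarrow> (square \<times> square) set" where
  "squares_of_rows g = {((i, i + k), (i', i' + (k + 1))) | k i i'. k \<in> {lo..hi} \<and> (i, i') \<in> g k}"

lemma rows_links_at:
  assumes E: "E \<in> linkages D" shows "rows E k \<in> links_at k"
proof -
  have "inj_on fst (rows E k)" "inj_on snd (rows E k)"
    using linkage_fst_inj[OF E] linkage_snd_inj[OF E] by (fastforce simp: rows_def inj_on_def)+
  moreover have "rows E k \<subseteq> {(i, i'). cnt mu k < i \<and> i \<le> cnt lam k \<and>
      cnt mu (k + 1) < i' \<and> i' \<le> cnt lam (k + 1) \<and> (i' = i \<or> i' = i - 1)}"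
  proof clarify
    fix i i' assume "(i, i') \<in> rows E k"
    then have "(i, i + k) \<in> D \<and> (i', i' + (k + 1)) \<in> D \<and> next_square (i, i + k) (i', i' + (k + 1))"
      using linkage_nextD[OF E] by (simp add: rows_def)
    then show "cnt mu k < i \<and> i \<le> cnt lam k \<and>
      cnt mu (k + 1) < i' \<and> i' \<le> cnt lam (k + 1) \<and> (i' = i \<or> i' = i - 1)"
      unfolding mem_D_content by (auto simp: next_square_def)
  qed
  ultimately show ?thesis by (simp add: row_links_def)
qed

lemma rows_squares: "k \<in> {lo..hi} \<Longrightarrow> rows (squares_of_rows g) k = g k"
  by (auto simp: rows_def squares_of_rows_def)

lemma squares_rows:
  assumes E: "E \<in> linkages D" and g: "\<And>k. k \<in> {lo..hi} \<Longrightarrow> g k = rows E k"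
  shows "squares_of_rows g = E"
proof (rule set_eqI, clarify)
  fix i j i' j'
  show "((i, j), (i', j')) \<in> squares_of_rows g \<longleftrightarrow> ((i, j), (i', j')) \<in> E"
  proof
    assume "((i, j), (i', j')) \<in> E"
    then have "(i, j) \<in> D" "next_square (i, j) (i', j')" using linkage_nextD[OF E] by auto
    then have "j - i \<in> {lo..hi}" "j' = i' + (j - i + 1)"
      using content_range[of "(i, j)"] content_next[of "(i, j)" "(i', j')"] by auto
    then show "((i, j), (i', j')) \<in> squares_of_rows g"
      using \<open>((i, j), (i', j')) \<in> E\<close> g[of "j - i"] unfolding squares_of_rows_def rows_def
      by (intro CollectI exI[of _ "j - i"] exI[of _ i] exI[of _ i']) auto
  qed (use g in \<open>auto simp: squares_of_rows_def rows_def\<close>)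
qed

text \<open>This is the independence of the snakes: links with a common start or a common end have
  the same contents, so injectivity is a condition on each \<open>g k\<close> separately.\<close>

lemma squares_of_rows_linkage:
  assumes g: "\<And>k. k \<in> {lo..hi} \<Longrightarrow> g k \<in> links_at k"
  shows "squares_of_rows g \<in> linkages D"
proof -
  have gk: "inj_on fst (g k)" "inj_on snd (g k)"
    "\<And>i i'. (i, i') \<in> g k \<Longrightarrow> (i, i + k) \<in> D \<and> (i', i' + (k + 1)) \<in> D \<and> (i' = i \<or> i' = i - 1)"
    if "k \<in> {lo..hi}" for k
    unfolding mem_D_content using g[OF that] by (auto simp: row_links_def)
  have "squares_of_rows g \<subseteq> {(s, t). s \<in> D \<and> t \<in> D \<and> next_square s t}"
    using gk(3) by (fastforce simp: squares_of_rows_def next_square_def)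
  moreover have "inj_on fst (squares_of_rows g)"
    using gk(1) by (fastforce simp: squares_of_rows_def inj_on_def)
  moreover have "inj_on snd (squares_of_rows g)"
    using gk(2) by (fastforce simp: squares_of_rows_def inj_on_def)
  ultimately show ?thesis by (simp add: linkages_def)
qed

lemma card_linkage:
  assumes E: "E \<in> linkages D" shows "card E = (\<Sum>k\<in>{lo..hi}. card (rows E k))"
proof -
  let ?f = "\<lambda>(k, i, i'). ((i, i + k), (i', i' + (k + 1::int)))"
  have "squares_of_rows (rows E) = ?f ` (SIGMA k:{lo..hi}. rows E k)"
    by (force simp: squares_of_rows_def)
  then have eq: "E = ?f ` (SIGMA k:{lo..hi}. rows E k)" using squares_rows[OF E refl] by simp
  have inj: "inj ?f" by (auto intro!: injI)
  have "card E = card (?f ` (SIGMA k:{lo..hi}. rows E k))" using eq by (rule arg_cong)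
  also have "\<dots> = card (SIGMA k:{lo..hi}. rows E k)"
    by (rule card_image[OF inj_on_subset[OF inj subset_UNIV]])
  also have "\<dots> = (\<Sum>k\<in>{lo..hi}. card (rows E k))"
    using finite_row_link[OF rows_links_at[OF E]] by (intro card_SigmaI) auto
  finally show ?thesis .
qed

definition total_links :: nat where "total_links = (\<Sum>k\<in>{lo..hi}. max_links k)"

lemma card_linkage_le: "E \<in> linkages D \<Longrightarrow> card E \<le> total_links"
  unfolding total_links_def card_linkage by (intro sum_mono card_links_at_le rows_links_at)

lemma card_linkage_max_iff:
  assumes E: "E \<in> linkages D"
  shows "card E = total_links \<longleftrightarrow> (\<forall>k\<in>{lo..hi}. card (rows E k) = max_links k)"
proof
  assume "card E = total_links"
  then show "\<forall>k\<in>{lo..hi}. card (rows E k) = max_links k"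
    unfolding total_links_def card_linkage[OF E]
    using sum_mono_inv[of "\<lambda>k. card (rows E k)" "{lo..hi}" max_links] card_links_at_le rows_links_at[OF E]
    by blast
qed (simp add: total_links_def card_linkage[OF E])

lemma card_max_linkages:
  "int (card {E \<in> linkages D. card E = total_links}) = (int (num_interval_sets lam mu))\<^sup>2"
proof -
  have sub: "Lset \<subseteq> {lo..hi}" "Rset \<subseteq> {lo..hi}" using not_boundary by force+
  let ?X = "\<lambda>k. {G \<in> links_at k. card G = max_links k}"
  \<comment> \<open>Restricted functions are \<open>undefined\<close> outside
    \<open>{lo..hi}\<close>, so each linkage corresponds to exactly one element of the
    product.\<close>
  have "bij_betw (\<lambda>E. \<lambda>k\<in>{lo..hi}. rows E k) {E \<in> linkages D. card E = total_links} (Pi\<^sub>E {lo..hi} ?X)"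
  proof (rule bij_betw_byWitness[where f' = squares_of_rows])
    show "\<forall>E\<in>{E \<in> linkages D. card E = total_links}. squares_of_rows (\<lambda>k\<in>{lo..hi}. rows E k) = E"
      using squares_rows by simp
    show "\<forall>g\<in>Pi\<^sub>E {lo..hi} ?X. (\<lambda>k\<in>{lo..hi}. rows (squares_of_rows g) k) = g"
    proof
      fix g assume g: "g \<in> Pi\<^sub>E {lo..hi} ?X"
      show "(\<lambda>k\<in>{lo..hi}. rows (squares_of_rows g) k) = g"
      proof
        fix k show "(\<lambda>k\<in>{lo..hi}. rows (squares_of_rows g) k) k = g k"
          using PiE_arb[OF g, of k] by (cases "k \<in> {lo..hi}") (simp_all add: rows_squares)
      qed
    qed
    show "(\<lambda>E. \<lambda>k\<in>{lo..hi}. rows E k) ` {E \<in> linkages D. card E = total_links} \<subseteq> Pi\<^sub>E {lo..hi} ?X"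
      using rows_links_at card_linkage_max_iff by auto
    show "squares_of_rows ` Pi\<^sub>E {lo..hi} ?X \<subseteq> {E \<in> linkages D. card E = total_links}"
    proof clarify
      fix g assume g: "g \<in> Pi\<^sub>E {lo..hi} ?X"
      then have gk: "g k \<in> links_at k" "card (g k) = max_links k" if "k \<in> {lo..hi}" for k
        using that by auto
      have l: "squares_of_rows g \<in> linkages D" using gk(1) by (rule squares_of_rows_linkage)
      then show "squares_of_rows g \<in> linkages D \<and> card (squares_of_rows g) = total_links"
        using gk(2) card_linkage_max_iff[OF l] by (simp add: rows_squares)
    qed
  qed
  then have "card {E \<in> linkages D. card E = total_links} = card (Pi\<^sub>E {lo..hi} ?X)"
    by (rule bij_betw_same_card)
  then have "int (card {E \<in> linkages D. card E = total_links}) = (\<Prod>k\<in>{lo..hi}. int (card (?X k)))"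
    by (simp add: card_PiE)
  also have "\<dots> = (\<Prod>k\<in>{lo..hi}. (if k \<in> Lset then N (k + 1) else 1)) *
      (\<Prod>k\<in>{lo..hi}. (if k \<in> Rset then N k else 1))"
    unfolding card_max_links_at prod.distrib ..
  also have "(\<Prod>k\<in>{lo..hi}. (if k \<in> Lset then N (k + 1) else 1)) = (\<Prod>k\<in>Lset. N (k + 1))"
    by (rule prod.mono_neutral_cong_right) (use sub in auto)
  also have "(\<Prod>k\<in>{lo..hi}. (if k \<in> Rset then N k else 1)) = (\<Prod>k\<in>Rset. N k)"
    by (rule prod.mono_neutral_cong_right) (use sub in auto)
  finally show ?thesis
    by (simp add: power2_eq_square num_interval_sets_eq_prod_Lset[symmetric]
        num_interval_sets_eq_prod_Rset[symmetric])
qed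

section \<open>The minimum number of strips and the count of minimal decompositions\<close>

text \<open>At a right end \<open>v\<close> the value \<open>N v\<close> exceeds the nonnegative
  \<open>N (v + 1)\<close> by one. Positivity is what shows that a maximum linkage exists.\<close>

lemma num_interval_sets_pos: "0 < num_interval_sets lam mu"
proof -
  have "0 < (\<Prod>v\<in>Rset. N v)"
  proof (rule prod_pos)
    fix v assume "v \<in> Rset"
    then show "0 < N v" using N_Suc[of v] N_nonneg[of "v + 1"] by simp
  qed
  then show ?thesis by (simp add: num_interval_sets_eq_prod_Rset[symmetric])
qed

text \<open>\<open>N k + N (k + 1)\<close> is twice the smaller value, plus 1 if \<open>k\<close>
  lies in \<open>Lset\<close> or \<open>Rset\<close>. Summing over \<open>k\<close> counts every
  square twice, and the two disjoint sets have equal size.\<close>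

lemma card_D_eq: "int (card D) = int total_links + int (card Lset)"
proof -
  have "int (card D) = (\<Sum>k\<in>{lo..hi}. N k)"
    using sum_by_content[of "\<lambda>_. 1"] by simp
  moreover have "(\<Sum>k\<in>{lo..hi}. N k) = (\<Sum>k\<in>{lo..hi}. N (k + 1))"
  proof -
    have "(\<Sum>k\<in>{lo..hi}. N (k + 1)) = (\<Sum>k\<in>{lo+1..hi+1}. N k)"
      by (rule sum.reindex_bij_witness[of _ "\<lambda>k. k - 1" "\<lambda>k. k + 1"]) auto
    also have "\<dots> = (\<Sum>k\<in>{lo..hi}. N k)"
      by (rule sum.mono_neutral_cong) (auto intro: N_low N_high)
    finally show ?thesis by simp
  qed
  moreover have "(\<Sum>k\<in>{lo..hi}. N k) + (\<Sum>k\<in>{lo..hi}. N (k + 1)) =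
      2 * (\<Sum>k\<in>{lo..hi}. int (max_links k)) + (\<Sum>k\<in>{lo..hi}. of_bool (k \<in> Lset)) + (\<Sum>k\<in>{lo..hi}. of_bool (k \<in> Rset))"
    unfolding sum_distrib_left sum.distrib[symmetric]
  proof (rule sum.cong[OF refl])
    fix k show "N k + N (k + 1) = 2 * int (max_links k) + of_bool (k \<in> Lset) + of_bool (k \<in> Rset)"
      using N_nonneg[of k] N_nonneg[of "k + 1"] N_Suc[of k]
      by (cases "k \<in> beads lam"; cases "k \<in> beads mu") (auto simp: max_links_def)
  qed
  moreover have "{k \<in> {lo..hi}. k \<in> Lset} = Lset" "{k \<in> {lo..hi}. k \<in> Rset} = Rset"
    using not_boundary by force+
  ultimately show ?thesis
    using card_filter_int[of "{lo..hi}" "\<lambda>k. k \<in> Lset"] card_filter_int[of "{lo..hi}" "\<lambda>k. k \<in> Rset"]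
      card_Lset_Rset by (simp add: total_links_def)
qed

lemma card_bs_decomposition:
  assumes "bs_decomposition lam mu P"
  shows "card P + card (links P) = card Lset + total_links"
  using card_chains[OF links_linkage[OF assms]] chains_links[OF assms] card_D_eq by simp

text \<open>Fewer strips would need more links than the snakes allow.\<close>

lemma card_bs_decomposition_ge: "bs_decomposition lam mu P \<Longrightarrow> card Lset \<le> card P"
  using card_bs_decomposition card_linkage_le[OF links_linkage] by fastforce

lemma ex_minimal: "\<exists>P. bs_decomposition lam mu P \<and> card P = card Lset"
proof -
  have "card {E \<in> linkages D. card E = total_links} \<noteq> 0"
    using card_max_linkages num_interval_sets_pos by (auto simp del: of_nat_eq_0_iff)
  then obtain E where E: "E \<in> linkages D" "card E = total_links"
    by (metis (mono_tags, lifting) card.empty empty_Collect_eq)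
  then have "card (chain E ` D) = card Lset" using card_chains[OF E(1)] card_D_eq by simp
  then show ?thesis using bs_decomposition_chains[OF E(1)] by blast
qed

lemma minimal_bsd_iff: "minimal_bsd lam mu P \<longleftrightarrow> bs_decomposition lam mu P \<and> card P = card Lset"
  unfolding minimal_bsd_def using ex_minimal card_bs_decomposition_ge by (metis antisym)

lemma mbsd_eq: "mbsd lam mu = (num_interval_sets lam mu)\<^sup>2"
proof -
  have "bij_betw (\<lambda>E. chain E ` D) {E \<in> linkages D. card E = total_links} {P. minimal_bsd lam mu P}"
  proof (rule bij_betw_byWitness[where f' = links])
    show "\<forall>E\<in>{E \<in> linkages D. card E = total_links}. links (chain E ` D) = E" using links_chains by blast
    show "\<forall>P\<in>{P. minimal_bsd lam mu P}. chain (links P) ` D = P"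
      using chains_links by (simp add: minimal_bsd_def)
    show "(\<lambda>E. chain E ` D) ` {E \<in> linkages D. card E = total_links} \<subseteq> {P. minimal_bsd lam mu P}"
      unfolding minimal_bsd_iff using bs_decomposition_chains card_chains card_D_eq by fastforce
    show "links ` {P. minimal_bsd lam mu P} \<subseteq> {E \<in> linkages D. card E = total_links}"
      unfolding minimal_bsd_iff using links_linkage card_bs_decomposition by fastforce
  qed
  then have "mbsd lam mu = card {E \<in> linkages D. card E = total_links}"
    unfolding mbsd_def by (rule bij_betw_same_card[symmetric])
  then have "int (mbsd lam mu) = int ((num_interval_sets lam mu)\<^sup>2)" using card_max_linkages by simp
  then show ?thesis by (simp only: of_nat_eq_iff)
qed

end

section \<open>Tableaux as sequences of bead moves\<close>

text \<open>A border strip decomposes itself with one block, so the rank is at most 1, and it is not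
  0 since the strip is nonempty. Conversely, for rank 1 a minimal decomposition has one block, which
  is the whole shape.\<close>

lemma (in skew_shape) border_strip_D_iff:
  "border_strip D \<longleftrightarrow> (\<exists>u v. u < v \<and> u \<in> beads mu \<and> v \<notin> beads mu \<and> beads lam = insert v (beads mu - {u}))"
proof
  assume b: "border_strip D"
  then have "D \<noteq> {}" by (simp add: border_strip_def)
  then have "bs_decomposition lam mu {D}"
    using b by (simp add: bs_decomposition_def partition_on_space)
  then have le: "card Lset \<le> 1" using card_bs_decomposition_ge by fastforce
  have "card Lset \<noteq> 0"
  proof
    assume "card Lset = 0"
    then have "Lset = {}" "Rset = {}"
      using card_Lset_Rset card_0_eq[OF finite_Lset] card_0_eq[OF finite_Rset] by metis+
    then have "lam = mu" using beads_inject[OF part_lam part_mu] by blast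
    then show False using \<open>D \<noteq> {}\<close> by (auto simp: skew_def)
  qed
  then have "card Lset = 1" "card Rset = 1" using le card_Lset_Rset by auto
  then obtain u v where uv: "Lset = {u}" "Rset = {v}" by (meson card_1_singletonE)
  have "\<not> v < u"
  proof
    assume "v < u"
    then have "{x \<in> Lset. x < u} = {}" "{x \<in> Rset. x < u} = {v}" unfolding uv by auto
    then have "N u = - 1" unfolding N_eq_below by (simp only: card.empty) simp
    then show False using N_nonneg[of u] by simp
  qed
  moreover have "u \<noteq> v" using uv by blast
  ultimately have "u < v" by simp
  moreover have "beads lam = insert v (beads mu - {u})" using uv by blast
  ultimately show "\<exists>u v. u < v \<and> u \<in> beads mu \<and> v \<notin> beads mu \<and> beads lam = insert v (beads mu - {u})"
    using uv by blast
next
  assume "\<exists>u v. u < v \<and> u \<in> beads mu \<and> v \<notin> beads mu \<and> beads lam = insert v (beads mu - {u})"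
  then obtain u v where "u < v" "u \<in> beads mu" "v \<notin> beads mu" "beads lam = insert v (beads mu - {u})"
    by blast
  then have "Lset = {u}" by auto
  then obtain P where P: "bs_decomposition lam mu P" "card P = 1" using ex_minimal by auto
  then obtain B where "P = {B}" by (meson card_1_singletonE)
  then show "border_strip D" using P(1) by (auto simp: bs_decomposition_def partition_on_def)
qed

text \<open>Containment comes with the bead move: moving a bead to the right enlarges a partition,
  and beads determine it.\<close>

lemma strip_iff:
  assumes "is_partition \<alpha>" "is_partition \<beta>"
  shows "contained \<beta> \<alpha> \<and> border_strip (skew \<alpha> \<beta>) \<longleftrightarrow>
    (\<exists>u v. u < v \<and> u \<in> beads \<beta> \<and> v \<notin> beads \<beta> \<and> beads \<alpha> = insert v (beads \<beta> - {u}))"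
proof (cases "contained \<beta> \<alpha>")
  case True
  then show ?thesis using skew_shape.border_strip_D_iff[OF skew_shape.intro] assms by simp
next
  case False
  then show ?thesis using ex_partition_move_bead[OF assms(2)] beads_inject[OF assms(1)] by metis
qed

definition move_bead :: "nat list \<Rightarrow> int \<times> int \<Rightarrow> nat list" where
  "move_bead \<alpha> p = (THE \<beta>. is_partition \<beta> \<and> beads \<beta> = insert (snd p) (beads \<alpha> - {fst p}))"

lemma move_bead_eqI:
  "is_partition \<beta> \<Longrightarrow> beads \<beta> = insert v (beads \<alpha> - {u}) \<Longrightarrow> move_bead \<alpha> (u, v) = \<beta>"
  unfolding move_bead_def by (rule the_equality) (auto intro: beads_inject)

lemma move_bead:
  assumes "is_partition \<alpha>" "u < v" "u \<in> beads \<alpha>" "v \<notin> beads \<alpha>"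
  shows "is_partition (move_bead \<alpha> (u, v))"
    and "beads (move_bead \<alpha> (u, v)) = insert v (beads \<alpha> - {u})"
  using ex_partition_move_bead[OF assms(1,3,4,2)] move_bead_eqI by metis+

fun tableau_of_moves :: "nat list \<Rightarrow> (int \<times> int) list \<Rightarrow> nat list list" where
  "tableau_of_moves \<alpha> [] = [\<alpha>]"
| "tableau_of_moves \<alpha> (p # ps) = \<alpha> # tableau_of_moves (move_bead \<alpha> p) ps"

fun moves :: "int set \<Rightarrow> (int \<times> int) list \<Rightarrow> int set \<Rightarrow> bool" where
  "moves X [] A \<longleftrightarrow> X = A"
| "moves X ((u, v) # ps) A \<longleftrightarrow> u < v \<and> u \<in> X \<and> v \<notin> X \<and> moves (insert v (X - {u})) ps A"

lemma length_tableau_of_moves [simp]: "length (tableau_of_moves \<alpha> ps) = Suc (length ps)"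
  by (induction ps arbitrary: \<alpha>) auto

lemma hd_tableau_of_moves [simp]: "hd (tableau_of_moves \<alpha> ps) = \<alpha>"
  by (cases ps) auto

lemma bs_tableau_single: "bs_tableau lam mu [\<alpha>] \<longleftrightarrow> \<alpha> = mu \<and> \<alpha> = lam \<and> is_partition \<alpha>"
  by (auto simp: bs_tableau_def)

lemma all_nat_iff: "(\<forall>i. P i) \<longleftrightarrow> P 0 \<and> (\<forall>i. P (Suc i))"
  by (metis not0_implies_Suc)

lemma ex_nat_iff: "(\<exists>i. P i) \<longleftrightarrow> P 0 \<or> (\<exists>i. P (Suc i))"
  by (metis not0_implies_Suc)

lemma bs_tableau_Cons:
  "bs_tableau lam mu (\<alpha> # \<beta> # T) \<longleftrightarrow> \<alpha> = mu \<and> is_partition mu \<and> contained mu \<beta> \<and>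
     border_strip (skew \<beta> mu) \<and> bs_tableau lam \<beta> (\<beta> # T)"
  unfolding bs_tableau_def
  by (subst all_nat_iff) auto

lemma tableau_strips_single: "tableau_strips [\<alpha>] = {}"
  by (simp add: tableau_strips_def)

lemma tableau_strips_Cons:
  "tableau_strips (\<alpha> # \<beta> # T) = insert (skew \<beta> \<alpha>) (tableau_strips (\<beta> # T))"
proof (rule set_eqI)
  fix B
  show "B \<in> tableau_strips (\<alpha> # \<beta> # T) \<longleftrightarrow> B \<in> insert (skew \<beta> \<alpha>) (tableau_strips (\<beta> # T))"
    unfolding tableau_strips_def mem_Collect_eq insert_iff by (subst ex_nat_iff) auto
qed

lemma bs_tableau_iff_moves:
  assumes "is_partition lam" "is_partition \<alpha>"
  shows "bs_tableau lam \<alpha> T \<longleftrightarrow> (\<exists>ps. moves (beads \<alpha>) ps (beads lam) \<and> T = tableau_of_moves \<alpha> ps)"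
  using assms(2)
proof (induction T arbitrary: \<alpha> rule: induct_list012)
  case 1
  have "[] \<noteq> tableau_of_moves \<alpha> ps" for ps by (cases ps) auto
  then show ?case by (auto simp: bs_tableau_def)
next
  case (2 \<gamma>)
  have "bs_tableau lam \<alpha> [\<gamma>] \<longleftrightarrow> \<gamma> = \<alpha> \<and> beads \<alpha> = beads lam"
    using beads_inject[OF assms(1) 2] 2 by (auto simp: bs_tableau_single)
  also have "\<dots> \<longleftrightarrow> (\<exists>ps. moves (beads \<alpha>) ps (beads lam) \<and> [\<gamma>] = tableau_of_moves \<alpha> ps)"
  proof
    assume "\<exists>ps. moves (beads \<alpha>) ps (beads lam) \<and> [\<gamma>] = tableau_of_moves \<alpha> ps"
    then obtain ps where ps: "moves (beads \<alpha>) ps (beads lam)" "[\<gamma>] = tableau_of_moves \<alpha> ps" by blast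
    then have "ps = []" using length_tableau_of_moves[of \<alpha> ps] by (metis length_Cons list.size(3) nat.inject length_0_conv)
    then show "\<gamma> = \<alpha> \<and> beads \<alpha> = beads lam" using ps by simp
  qed (auto intro!: exI[of _ "[]"])
  finally show ?case .
next
  case (3 \<gamma> \<beta> T)
  show ?case
  proof
    assume "bs_tableau lam \<alpha> (\<gamma> # \<beta> # T)"
    then have t: "\<gamma> = \<alpha>" "contained \<alpha> \<beta>" "border_strip (skew \<beta> \<alpha>)" "bs_tableau lam \<beta> (\<beta> # T)"
      by (auto simp: bs_tableau_Cons)
    have \<beta>: "is_partition \<beta>" using t(4) by (simp add: bs_tableau_def)
    obtain u v where uv: "u < v" "u \<in> beads \<alpha>" "v \<notin> beads \<alpha>" "beads \<beta> = insert v (beads \<alpha> - {u})"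
      using strip_iff[OF \<beta> 3(3)] t by blast
    obtain ps where ps: "moves (beads \<beta>) ps (beads lam)" "\<beta> # T = tableau_of_moves \<beta> ps"
      using 3(2)[OF \<beta>] t(4) by blast
    have "moves (beads \<alpha>) ((u, v) # ps) (beads lam)" using uv ps by simp
    moreover have "\<gamma> # \<beta> # T = tableau_of_moves \<alpha> ((u, v) # ps)"
      using ps(2) t(1) move_bead_eqI[OF \<beta> uv(4)] by simp
    ultimately show "\<exists>ps. moves (beads \<alpha>) ps (beads lam) \<and> \<gamma> # \<beta> # T = tableau_of_moves \<alpha> ps" by blast
  next
    assume "\<exists>ps. moves (beads \<alpha>) ps (beads lam) \<and> \<gamma> # \<beta> # T = tableau_of_moves \<alpha> ps"
    then obtain ps where ps: "moves (beads \<alpha>) ps (beads lam)" "\<gamma> # \<beta> # T = tableau_of_moves \<alpha> ps" by blast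
    then obtain u v qs where qs: "ps = (u, v) # qs" by (cases ps) auto
    then have T: "\<gamma> = \<alpha>" "\<beta> # T = tableau_of_moves (move_bead \<alpha> (u, v)) qs" using ps(2) by auto
    then have \<beta>: "\<beta> = move_bead \<alpha> (u, v)" by (metis hd_tableau_of_moves list.sel(1))
    have uv: "u < v" "u \<in> beads \<alpha>" "v \<notin> beads \<alpha>" "moves (insert v (beads \<alpha> - {u})) qs (beads lam)"
      using ps(1) qs by auto
    have b: "is_partition \<beta>" "beads \<beta> = insert v (beads \<alpha> - {u})"
      using move_bead[OF 3(3) uv(1-3)] \<beta> by auto
    have "bs_tableau lam \<beta> (\<beta> # T)" using 3(2)[OF b(1)] T(2) uv(4) b(2) \<beta> by auto
    moreover have "contained \<alpha> \<beta> \<and> border_strip (skew \<beta> \<alpha>)" using strip_iff[OF b(1) 3(3)] uv b(2) by blast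
    ultimately show "bs_tableau lam \<alpha> (\<gamma> # \<beta> # T)" using T(1) 3(3) by (simp add: bs_tableau_Cons)
  qed
qed

lemma tableau_of_moves_inject:
  assumes "is_partition \<alpha>" "moves (beads \<alpha>) ps A" "moves (beads \<alpha>) qs A"
    "tableau_of_moves \<alpha> ps = tableau_of_moves \<alpha> qs"
  shows "ps = qs"
  using assms
proof (induction ps arbitrary: \<alpha> qs)
  case Nil
  then show ?case using length_tableau_of_moves[of \<alpha> qs] by (metis length_0_conv length_tableau_of_moves nat.inject)
next
  case (Cons p ps)
  obtain q rs where qs: "qs = q # rs" using Cons.prems(4) by (cases qs) (auto, metis length_tableau_of_moves list.size(3) nat.distinct(1))
  obtain u v u' v' where pq: "p = (u, v)" "q = (u', v')" by (cases p; cases q)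
  have uv: "u < v" "u \<in> beads \<alpha>" "v \<notin> beads \<alpha>" "u' < v'" "u' \<in> beads \<alpha>" "v' \<notin> beads \<alpha>"
    and m: "moves (insert v (beads \<alpha> - {u})) ps A" "moves (insert v' (beads \<alpha> - {u'})) rs A"
    and t: "tableau_of_moves (move_bead \<alpha> p) ps = tableau_of_moves (move_bead \<alpha> q) rs"
    using Cons.prems by (auto simp: qs pq)
  have eq: "move_bead \<alpha> p = move_bead \<alpha> q" using t by (metis hd_tableau_of_moves)
  have mb: "is_partition (move_bead \<alpha> p)" "beads (move_bead \<alpha> p) = insert v (beads \<alpha> - {u})"
    "beads (move_bead \<alpha> q) = insert v' (beads \<alpha> - {u'})"
    using move_bead[OF Cons.prems(1)] uv pq by auto
  then have "insert v (beads \<alpha> - {u}) = insert v' (beads \<alpha> - {u'})" using eq by simp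
  \<comment> \<open>The bead sets reveal the move: \<open>u\<close> is the bead that disappears and
    \<open>v\<close> the one that appears.\<close>
  moreover have "u \<notin> insert v (beads \<alpha> - {u})" "v \<in> insert v (beads \<alpha> - {u})" using uv by auto
  ultimately have "u \<notin> insert v' (beads \<alpha> - {u'})" "v \<in> insert v' (beads \<alpha> - {u'})" by simp_all
  then have "u = u'" "v = v'" using uv by auto
  moreover have "ps = rs"
  proof (rule Cons.IH[OF mb(1)])
    show "moves (beads (move_bead \<alpha> p)) ps A" unfolding mb(2) by (rule m(1))
    show "moves (beads (move_bead \<alpha> p)) rs A" unfolding eq mb(3) by (rule m(2))
    show "tableau_of_moves (move_bead \<alpha> p) ps = tableau_of_moves (move_bead \<alpha> p) rs"
      using t unfolding eq .
  qed
  ultimately show ?case by (simp add: qs pq)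
qed

lemma skew_split:
  assumes "contained \<alpha> \<beta>" "contained \<beta> \<gamma>"
  shows "skew \<gamma> \<alpha> - skew \<beta> \<alpha> = skew \<gamma> \<beta>" "skew \<beta> \<alpha> \<subseteq> skew \<gamma> \<alpha>" "disjnt (skew \<beta> \<alpha>) (skew \<gamma> \<beta>)"
  using assms by (fastforce simp: skew_def contained_def disjnt_iff)+

text \<open>The strips of a tableau are nonempty and disjoint, hence different, so their number is
  the number of steps. Minimality thereby becomes a condition on the length of the chain.\<close>

lemma tableau_strips_decomposition:
  assumes "bs_tableau lam mu T"
  shows "contained mu lam \<and> bs_decomposition lam mu (tableau_strips T) \<and>
    finite (tableau_strips T) \<and> Suc (card (tableau_strips T)) = length T"
  using assms
proof (induction T arbitrary: mu rule: induct_list012)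
  case 1
  then show ?case by (simp add: bs_tableau_def)
next
  case (2 \<gamma>)
  then have "lam = mu" unfolding bs_tableau_single by blast
  then show ?case
    by (simp add: tableau_strips_single contained_def bs_decomposition_def partition_on_def skew_def)
next
  case (3 \<gamma> \<beta> T)
  then have t: "\<gamma> = mu" "contained mu \<beta>" "border_strip (skew \<beta> mu)" "bs_tableau lam \<beta> (\<beta> # T)"
    by (auto simp: bs_tableau_Cons)
  let ?P = "tableau_strips (\<beta> # T)"
  have IH: "contained \<beta> lam" "bs_decomposition lam \<beta> ?P" "finite ?P" "Suc (card ?P) = length (\<beta> # T)"
    using "3.IH"(2)[OF t(4)] by auto
  then have P: "partition_on (skew lam \<beta>) ?P" "\<forall>B\<in>?P. border_strip B" by (auto simp: bs_decomposition_def)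
  have U: "\<Union>?P = skew lam \<beta>" using P(1) by (simp add: partition_on_def)
  note split = skew_split[OF t(2) IH(1)]
  have ne: "skew \<beta> mu \<noteq> {}" using t(3) by (simp add: border_strip_def)
  have "partition_on (skew lam mu) (insert (skew \<beta> mu) ?P)"
    by (subst partition_on_insert) (use split P(1) U ne in auto)
  then have "bs_decomposition lam mu (insert (skew \<beta> mu) ?P)"
    using P(2) t(3) by (simp add: bs_decomposition_def)
  moreover have "skew \<beta> mu \<notin> ?P" using split(3) U ne by (auto simp: disjnt_iff)
  moreover have "contained mu lam" using t(2) IH(1) unfolding contained_def by force
  ultimately show ?case using IH t(1) by (simp add: tableau_strips_Cons)
qed

section \<open>Shortest sequences of bead moves\<close>

text \<open>A move takes at most one bead out of \<open>X - A\<close>, and in the end nothing may be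
  left of it.\<close>

lemma moves_length_ge:
  "moves X ps A \<Longrightarrow> finite (X - A) \<Longrightarrow> card (X - A) \<le> length ps"
proof (induction ps arbitrary: X)
  case (Cons p ps)
  obtain u v where p: "p = (u, v)" by (cases p)
  let ?Y = "insert v (X - {u})"
  have fin: "finite (?Y - A)" by (rule finite_subset[of _ "insert v (X - A)"]) (use Cons.prems in auto)
  have "card (X - A) \<le> card (insert u (?Y - A))" by (rule card_mono) (use fin in auto)
  also have "\<dots> \<le> Suc (card (?Y - A))" by (rule card_insert_le_m1 | simp add: card_insert_if fin)+
  also have "card (?Y - A) \<le> length ps" using Cons p fin by auto
  finally show ?case by simp
qed simp

text \<open>A shortest sequence has to move a bead of \<open>X - A\<close> to a position of \<open>A - X\<close> every time.\<close>

lemma shortest_moves_iff: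
  assumes "finite (X - A)" "finite (A - X)"
  shows "moves X ps A \<and> length ps = card (X - A) \<longleftrightarrow> distinct ps \<and> set ps \<in> pairings (X - A) (A - X)"
  using assms
proof (induction ps arbitrary: X)
  case Nil
  then show ?case by (auto simp: pairings_def bij_betw_def)
next
  case (Cons p ps)
  obtain u v where p: "p = (u, v)" by (cases p)
  let ?Y = "insert v (X - {u})"
  have IH: "moves ?Y ps A \<and> length ps = card (?Y - A) \<longleftrightarrow> distinct ps \<and> set ps \<in> pairings (X - A - {u}) (A - X - {v})"
    if "u \<in> X - A" "v \<in> A - X"
  proof -
    have "?Y - A = X - A - {u}" "A - ?Y = A - X - {v}" using that by auto
    then show ?thesis using Cons.IH[of ?Y] Cons.prems by simp
  qed
  have card: "card (?Y - A) = card (X - A) - 1" "0 < card (X - A)" if "u \<in> X - A" "v \<in> A - X"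
  proof -
    have "?Y - A = X - A - {u}" using that by auto
    then show "card (?Y - A) = card (X - A) - 1" "0 < card (X - A)"
      using that Cons.prems by (auto simp: card_gt_0_iff)
  qed
  show ?case
  proof
    assume m: "moves X (p # ps) A \<and> length (p # ps) = card (X - A)"
    then have uv: "u < v" "u \<in> X" "v \<notin> X" "moves ?Y ps A" by (auto simp: p)
    have fin: "finite (?Y - A)" by (rule finite_subset[of _ "insert v (X - A)"]) (use Cons.prems in auto)
    \<comment> \<open>The remaining moves number at least \<open>card (?Y - A)\<close>, so the first
      move must already shrink \<open>X - A\<close>. It would not if \<open>u\<close> were in
      \<open>A\<close> or \<open>v\<close> outside \<open>A\<close>.\<close>
    have le: "card (?Y - A) < card (X - A)" using moves_length_ge[OF uv(4) fin] m by simp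
    have u: "u \<in> X - A"
    proof (rule ccontr)
      assume "u \<notin> X - A"
      then have "X - A \<subseteq> ?Y - A" using uv by auto
      from card_mono[OF fin this] show False using le by simp
    qed
    have v: "v \<in> A - X"
    proof (rule ccontr)
      assume "v \<notin> A - X"
      then have "?Y - A = insert v (X - A - {u})" using uv by auto
      then have "card (?Y - A) = Suc (card (X - A - {u}))" using Cons.prems uv(3) by simp
      then show False using le u Cons.prems by simp
    qed
    have "length ps = card (?Y - A)" using m[THEN conjunct2] card(1)[OF u v] by simp
    then have ps: "distinct ps" "set ps \<in> pairings (X - A - {u}) (A - X - {v})" using IH[OF u v] uv(4) by auto
    moreover have "(u, v) \<notin> set ps" using ps(2) by (auto simp: pairings_def)
    ultimately show "distinct (p # ps) \<and> set (p # ps) \<in> pairings (X - A) (A - X)"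
      using insert_pairings[OF ps(2) u v uv(1)] by (simp add: p)
  next
    assume d: "distinct (p # ps) \<and> set (p # ps) \<in> pairings (X - A) (A - X)"
    then have uv: "u \<in> X - A" "v \<in> A - X" "u < v" by (auto simp: pairings_def p)
    \<comment> \<open>Any pair may come first: its source is occupied and its target free. Removing
      it leaves a pairing for the new bead set, since distinct pairs share no entry.\<close>
    have "set ps = set (p # ps) - {(u, v)}" using d by (auto simp: p)
    then have "set ps \<in> pairings (X - A - {u}) (A - X - {v})"
      using remove_pairings[of "set (p # ps)" "X - A" "A - X" u v] d by (simp add: p)
    then have "moves ?Y ps A \<and> length ps = card (?Y - A)" using IH[OF uv(1,2)] d by simp
    then show "moves X (p # ps) A \<and> length (p # ps) = card (X - A)"
      using card[OF uv(1,2)] uv by (simp add: p)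
  qed
qed

section \<open>The count of minimal tableaux\<close>

context skew_shape
begin

lemma minimal_bst_iff: "minimal_bst lam mu T \<longleftrightarrow> bs_tableau lam mu T \<and> length T = Suc (card Lset)"
  unfolding minimal_bst_def minimal_bsd_iff using tableau_strips_decomposition[of lam mu T] by auto

lemma mbst_eq: "mbst lam mu = fact (card Lset) * num_interval_sets lam mu"
proof -
  let ?M = "{ps. moves (beads mu) ps (beads lam) \<and> length ps = card Lset}"
  have "{T. minimal_bst lam mu T} = tableau_of_moves mu ` ?M"
    unfolding minimal_bst_iff bs_tableau_iff_moves[OF part_lam part_mu] by (auto simp: image_iff)
  moreover have "inj_on (tableau_of_moves mu) ?M"
    using tableau_of_moves_inject[OF part_mu] by (auto intro!: inj_onI)
  ultimately have "mbst lam mu = card ?M" unfolding mbst_def by (simp add: card_image)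
  also have "?M = (\<Union>I\<in>pairings Lset Rset. permutations_of_set I)"
    unfolding shortest_moves_iff[OF finite_Lset finite_Rset] by (auto simp: permutations_of_set_def)
  also have "card \<dots> = (\<Sum>I\<in>pairings Lset Rset. card (permutations_of_set I))"
  proof (rule card_UN_disjoint)
    show "\<forall>I\<in>pairings Lset Rset. \<forall>J\<in>pairings Lset Rset. I \<noteq> J \<longrightarrow>
        permutations_of_set I \<inter> permutations_of_set J = {}"
      by (auto simp: permutations_of_set_def)
  qed (simp_all add: finite_pairings finite_Lset finite_Rset)
  also have "\<dots> = (\<Sum>I\<in>pairings Lset Rset. fact (card Lset))"
  proof (rule sum.cong[OF refl])
    fix I assume "I \<in> pairings Lset Rset"
    then have b: "bij_betw fst I Lset" by (simp add: pairings_def)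
    then show "card (permutations_of_set I) = fact (card Lset)"
      using bij_betw_finite[OF b] finite_Lset bij_betw_same_card[OF b] by simp
  qed
  finally show ?thesis by (simp add: num_interval_sets_eq)
qed

end

theorem theorem4p5:
  fixes lam mu :: "nat list" and r :: nat
  assumes "is_partition lam" and "is_partition mu" and "contained mu lam"
    and "skew_rank lam mu = int r"
  shows "mbsd lam mu = (num_interval_sets lam mu)\<^sup>2 \<and>
         mbst lam mu = fact r * num_interval_sets lam mu"
proof -
  interpret skew_shape lam mu by (rule skew_shape.intro) fact+
  show ?thesis using mbsd_eq mbst_eq rank_eq assms(4) by simp
qed

end
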